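(* Let $\mathsf{a}\in(0,1)$ and $c_1,c_2\in(0,1/\mathsf{a})$. For each $N\ge1$ let $(\mathbf{L}_1,\mathbf{L}_2)$ have the law $\mathbb{P}^{(\mathsf{a},c_1,c_2)}_{\rm Geo}$ (for that $N$). As $N\to\infty$: (i) If $c_1,c_2\le1$, then $\mathbf{L}_1(N)/N\to \mathsf{a}/(1-\mathsf{a})$ in probability. (ii) If $c_1>1$ and $c_2<c_1<1/\mathsf{a}$, then $\mathbf{L}_1(N)/N\to \mathsf{a}/(c_1-\mathsf{a})$ in probability. (iii) If $c_2>1$ and $c_1<c_2<1/\mathsf{a}$, then $\mathbf{L}_1(N)/N\to \mathsf{a}c_2/(1-\mathsf{a}c_2)$ in probability. (iv) If $c_1=c_2=\mathsf{c}\in(1,1/\mathsf{a})$, then $\mathbf{L}_1(N)/N$ converges in distribution to $$\frac{\mathsf{a}}{\mathsf{c}-\mathsf{a}}\,U+\frac{\mathsf{a}\mathsf{c}}{1-\mathsf{a}\mathsf{c}}\,(1-U),$$ where $U$ is uniformly distributed on $[0,1]$.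
   Context: For $N\ge1$ and $(m_1,\dots,m_N),(n_1,\dots,n_N)\in\mathbb{Z}_{\ge0}^N$ let $\mathbf{L}_1(j)=\sum_{k=1}^j m_k$ and $\mathbf{L}_2(j)=\sum_{k=1}^j n_k$ for $1\le j\le N$, with $\mathbf{L}_1(0)=\mathbf{L}_2(0)=0$. For $\mathsf{a}\in(0,1)$ and $c_1,c_2\in(0,1/\mathsf{a})$ define the weight $$\mathbb{Q}_N^{(\mathsf{a},c_1,c_2)}(\mathbf{L}_1,\mathbf{L}_2)=\mathsf{a}^{\mathbf{L}_1(N)}\mathsf{a}^{\mathbf{L}_2(N)}(c_1c_2)^{\max_{1\le j\le N}(\mathbf{L}_2(j)-\mathbf{L}_1(j-1))}\,c_2^{\mathbf{L}_1(N)-\mathbf{L}_2(N)} .$$ Its sum over all pairs, $\mathcal{Z}^{(\mathsf{a},c_1,c_2)}(N)=\sum_{\mathbf{L}_1,\mathbf{L}_2}\mathbb{Q}_N^{(\mathsf{a},c_1,c_2)}(\mathbf{L}_1,\mathbf{L}_2)$, is finite, and $\mathbb{P}^{(\mathsf{a},c_1,c_2)}_{\rm Geo}=\mathbb{Q}_N^{(\mathsf{a},c_1,c_2)}/\mathcal{Z}^{(\mathsf{a},c_1,c_2)}(N)$ is the resulting probability measure on pairs $(\mathbf{L}_1,\mathbf{L}_2)$. (The marginal law of $\mathbf{L}_1$ is the stationary measure of geometric last passage percolation on a strip with bulk parameter $\mathsf{a}$ and boundary parameters $c_1,c_2$.) *)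

theory Defs
  imports "HOL-Probability.Probability"
begin

text \<open>
  A path is a function on \<open>{0..N}\<close> (undefined outside), the sequence of partial sums of an
  increment vector with entries in the natural numbers indexed by \<open>{1..N}\<close>.
\<close>

definition path_of :: "nat \<Rightarrow> (nat \<Rightarrow> nat) \<Rightarrow> nat \<Rightarrow> nat" where
  "path_of N m = (\<lambda>j\<in>{0..N}. \<Sum>k=1..j. m k)"

definition paths :: "nat \<Rightarrow> (nat \<Rightarrow> nat) set" where
  "paths N = path_of N ` ({1..N} \<rightarrow>\<^sub>E UNIV)"

text \<open>
  The differences \<open>L2 j - L1 (j - 1)\<close> and \<open>L1 N - L2 N\<close> may be negative, so they are taken in the
  integers and the powers are integer powers.
\<close>

definition Q_weight ::
  "real \<Rightarrow> real \<Rightarrow> real \<Rightarrow> nat \<Rightarrow> (nat \<Rightarrow> nat) \<times> (nat \<Rightarrow> nat) \<Rightarrow> real" where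
  "Q_weight a c1 c2 N = (\<lambda>(L1, L2).
     a ^ L1 N * a ^ L2 N
     * (c1 * c2) powi (MAX j\<in>{1..N}. int (L2 j) - int (L1 (j - 1)))
     * c2 powi (int (L1 N) - int (L2 N)))"

definition Z_Geo :: "real \<Rightarrow> real \<Rightarrow> real \<Rightarrow> nat \<Rightarrow> real" where
  "Z_Geo a c1 c2 N = (\<Sum>\<^sub>\<infinity>L\<in>paths N \<times> paths N. Q_weight a c1 c2 N L)"

definition P_Geo ::
  "real \<Rightarrow> real \<Rightarrow> real \<Rightarrow> nat \<Rightarrow> ((nat \<Rightarrow> nat) \<times> (nat \<Rightarrow> nat)) measure" where
  "P_Geo a c1 c2 N = point_measure (paths N \<times> paths N)
     (\<lambda>L. ennreal (Q_weight a c1 c2 N L / Z_Geo a c1 c2 N))"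

text \<open>
  Convergence in probability to a constant; the probability space may change with the index.
\<close>

definition conv_in_prob_const ::
  "(nat \<Rightarrow> 'a measure) \<Rightarrow> (nat \<Rightarrow> 'a \<Rightarrow> real) \<Rightarrow> real \<Rightarrow> bool" where
  "conv_in_prob_const M X v \<longleftrightarrow>
     (\<forall>\<epsilon>>0. (\<lambda>n. measure (M n) {\<omega> \<in> space (M n). \<bar>X n \<omega> - v\<bar> > \<epsilon>}) \<longlonglongrightarrow> 0)"

text \<open>
  The weights are positive with finite sum, so \<^const>\<open>P_Geo\<close> is a probability measure.
\<close>

lemma Q_weight_le:
  fixes a c1 c2 :: real
  assumes "0 < a" "a < 1" "0 < c1" "a * c1 < 1" "0 < c2" "a * c2 < 1" "N \<ge> 1"
    and L: "L1 \<in> paths N" "L2 \<in> paths N"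
  defines "r \<equiv> max a (max (a * c1) (a * c2))"
  shows "Q_weight a c1 c2 N (L1, L2) \<le> r ^ L1 N * r ^ L2 N"
proof -
  define K where "K = (MAX j\<in>{1..N}. int (L2 j) - int (L1 (j - 1)))"
  have mono: "L i \<le> L j" if "L \<in> paths N" "i \<le> j" "j \<le> N" for L i j
    using that by (auto simp: paths_def path_of_def intro!: sum_mono2)
  have L0: "L1 0 = 0" using L(1) by (auto simp: paths_def path_of_def)
  have K_ge: "int (L2 j) - int (L1 (j - 1)) \<le> K" if "j \<in> {1..N}" for j
    unfolding K_def using that by (intro Max_ge imageI) auto
  have "int (L2 1) - int (L1 (1 - 1)) \<le> K"
    using \<open>N \<ge> 1\<close> by (intro K_ge) auto
  hence K0: "0 \<le> K" using L0 by simp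
  have "int (L2 N) - int (L1 (N - 1)) \<le> K"
    using \<open>N \<ge> 1\<close> by (intro K_ge) auto
  moreover have "L1 (N - 1) \<le> L1 N" by (rule mono[OF L(1)]) auto
  ultimately have K1: "int (L2 N) - int (L1 N) \<le> K" by linarith
  have "int (L2 j) - int (L1 (j - 1)) \<le> int (L2 N)" if "j \<in> {1..N}" for j
    using mono[OF L(2), of j N] that by simp
  hence K2: "K \<le> int (L2 N)"
    unfolding K_def using \<open>N \<ge> 1\<close> by (subst Max_le_iff) auto
  have r: "a \<le> r" "a * c1 \<le> r" "a * c2 \<le> r" "0 < r"
    using assms by (auto simp: r_def)
  let ?p = "c1 * c2"
  have p0: "?p > 0" using assms by simp
  have Q: "Q_weight a c1 c2 N (L1, L2) = a ^ L1 N * a ^ L2 N * (?p powi K * c2 powi (int (L1 N) - int (L2 N)))"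
    by (simp add: Q_weight_def K_def mult.assoc)
  show ?thesis
  proof (cases "?p \<ge> 1")
    case True
    have "?p powi K \<le> ?p powi int (L2 N)"
      using True K2 by (intro power_int_increasing) auto
    hence "Q_weight a c1 c2 N (L1, L2)
        \<le> a ^ L1 N * a ^ L2 N * (?p powi int (L2 N) * c2 powi (int (L1 N) - int (L2 N)))"
      unfolding Q using assms by (intro mult_left_mono mult_right_mono) auto
    also have "\<dots> = (a * c2) ^ L1 N * (a * c1) ^ L2 N"
      using assms by (simp add: power_int_diff power_mult_distrib)
    also have "\<dots> \<le> r ^ L1 N * r ^ L2 N"
      using assms r by (intro mult_mono power_mono) auto
    finally show ?thesis .
  next
    case False
    show ?thesis
    proof (cases "L1 N \<le> L2 N")
      case le: True
      define d where "d = L2 N - L1 N"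
      have d: "L2 N = L1 N + d" using le by (simp add: d_def)
      have "?p powi K \<le> ?p powi int d"
        using False K1 p0 d by (intro power_int_decreasing) auto
      hence "Q_weight a c1 c2 N (L1, L2)
          \<le> a ^ L1 N * a ^ L2 N * (?p powi int d * c2 powi (int (L1 N) - int (L2 N)))"
        unfolding Q using assms by (intro mult_left_mono mult_right_mono) auto
      also have "\<dots> = a ^ L1 N * (a ^ L1 N * (a * c1) ^ d)"
        using assms by (simp add: d power_int_minus power_mult_distrib power_add field_simps)
      also have "\<dots> \<le> r ^ L1 N * (r ^ L1 N * r ^ d)"
        using assms r by (intro mult_mono power_mono) auto
      finally show ?thesis by (simp add: d power_add)
    next
      case gt: False
      define d where "d = L1 N - L2 N"
      have d: "L1 N = L2 N + d" using gt by (simp add: d_def)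
      have "?p powi K \<le> ?p powi 0"
        using False K0 p0 by (intro power_int_decreasing) auto
      hence "Q_weight a c1 c2 N (L1, L2)
          \<le> a ^ L1 N * a ^ L2 N * (?p powi 0 * c2 powi (int (L1 N) - int (L2 N)))"
        unfolding Q using assms by (intro mult_left_mono mult_right_mono) auto
      also have "\<dots> = (a ^ L2 N * (a * c2) ^ d) * a ^ L2 N"
        by (simp add: d power_mult_distrib power_add field_simps)
      also have "\<dots> \<le> (r ^ L2 N * r ^ d) * r ^ L2 N"
        using assms r by (intro mult_mono power_mono) auto
      finally show ?thesis by (simp add: d power_add)
    qed
  qed
qed

lemma summable_on_paths_power:
  fixes r :: real
  assumes "0 \<le> r" "r < 1"
  shows "(\<lambda>L. r ^ L N) summable_on paths N"
proof -
  let ?A = "{1..N} \<rightarrow>\<^sub>E (UNIV :: nat set)"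
  have "(\<lambda>n. norm (r ^ n)) summable_on (UNIV :: nat set)"
    using assms by (intro norm_summable_imp_summable_on) auto
  hence "Infinite_Set_Sum.abs_summable_on (\<lambda>n. r ^ n) (UNIV :: nat set)"
    using abs_summable_equivalent by blast
  hence "Infinite_Set_Sum.abs_summable_on (\<lambda>m. \<Prod>k\<in>{1..N}. r ^ m k) ?A"
    by (intro abs_summable_on_prod_PiE) auto
  hence "(\<lambda>m. \<Prod>k\<in>{1..N}. r ^ m k) summable_on ?A"
    using abs_summable_equivalent abs_summable_summable by blast
  hence "(\<lambda>m. r ^ path_of N m N) summable_on ?A"
    by (simp add: path_of_def power_sum)
  moreover have "inv_into ?A (path_of N) ` paths N \<subseteq> ?A"
    unfolding paths_def by (intro image_subsetI inv_into_into)
  ultimately have "(\<lambda>m. r ^ path_of N m N) summable_on inv_into ?A (path_of N) ` paths N"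
    by (rule summable_on_subset_banach)
  hence "((\<lambda>m. r ^ path_of N m N) \<circ> inv_into ?A (path_of N)) summable_on paths N"
    by (subst (asm) summable_on_reindex) (auto simp: paths_def inj_on_inv_into)
  thus ?thesis
    by (rule summable_on_cong[THEN iffD1, rotated]) (auto simp: paths_def f_inv_into_f)
qed

lemma Q_weight_pos:
  assumes "0 < a" "0 < c1" "0 < c2"
  shows "Q_weight a c1 c2 N L > 0"
  using assms by (auto simp: Q_weight_def split: prod.splits)

lemma Q_weight_summable:
  fixes a c1 c2 :: real
  assumes "a \<in> {0<..<1}" "c1 \<in> {0<..<1 / a}" "c2 \<in> {0<..<1 / a}" "N \<ge> 1"
  shows "Q_weight a c1 c2 N summable_on (paths N \<times> paths N)"
proof -
  have A: "0 < a" "a < 1" "0 < c1" "a * c1 < 1" "0 < c2" "a * c2 < 1"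
    using assms by (auto simp: field_simps)
  define r where "r = max a (max (a * c1) (a * c2))"
  have r: "0 \<le> r" "r < 1" using A by (auto simp: r_def)
  have s: "(\<lambda>L. r ^ L N) summable_on paths N"
    using r by (rule summable_on_paths_power)
  have "(\<lambda>(L1, L2). r ^ L1 N * r ^ L2 N) summable_on (paths N \<times> paths N)"
  proof (rule summable_on_SigmaI)
    show "((\<lambda>L2. case (L1, L2) of (L1, L2) \<Rightarrow> r ^ L1 N * r ^ L2 N) has_sum r ^ L1 N * (\<Sum>\<^sub>\<infinity>L2\<in>paths N. r ^ L2 N)) (paths N)" for L1
      unfolding prod.case using s by (intro has_sum_cmult_right has_sum_infsum)
    show "(\<lambda>L1. r ^ L1 N * (\<Sum>\<^sub>\<infinity>L2\<in>paths N. r ^ L2 N)) summable_on paths N"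
      using s by (rule summable_on_cmult_left)
  qed (use r in auto)
  thus ?thesis
  proof (rule summable_on_comparison_test)
    fix L assume "L \<in> paths N \<times> paths N"
    thus "Q_weight a c1 c2 N L \<le> (case L of (L1, L2) \<Rightarrow> r ^ L1 N * r ^ L2 N)"
      using Q_weight_le[OF A assms(4)] by (auto simp: r_def)
    show "0 \<le> Q_weight a c1 c2 N L"
      using Q_weight_pos[OF A(1,3,5)] less_imp_le by blast
  qed
qed

lemma prob_space_P_Geo:
  fixes a c1 c2 :: real
  assumes "a \<in> {0<..<1}" "c1 \<in> {0<..<1 / a}" "c2 \<in> {0<..<1 / a}" "N \<ge> 1"
  shows "prob_space (P_Geo a c1 c2 N)"
proof
  let ?S = "paths N \<times> paths N" and ?Q = "Q_weight a c1 c2 N"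
  have pos: "?Q L > 0" for L
    using assms by (intro Q_weight_pos) auto
  have sm: "?Q summable_on ?S"
    using assms by (rule Q_weight_summable)
  have "paths N \<noteq> {}"
    by (simp add: paths_def PiE_eq_empty_iff)
  then obtain L where L: "L \<in> ?S" by blast
  have "?Q L = (\<Sum>\<^sub>\<infinity>L\<in>{L}. ?Q L)" by simp
  also have "\<dots> \<le> Z_Geo a c1 c2 N"
    unfolding Z_Geo_def using L sm pos
    by (intro infsum_mono_neutral) (auto intro: less_imp_le)
  finally have Z: "Z_Geo a c1 c2 N > 0" using pos[of L] by linarith
  have "Infinite_Set_Sum.abs_summable_on ?Q ?S"
    using sm pos abs_summable_equivalent summable_on_iff_abs_summable_on_real by blast
  hence ab: "Infinite_Set_Sum.abs_summable_on (\<lambda>L. ?Q L / Z_Geo a c1 c2 N) ?S"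
    unfolding divide_inverse by (rule abs_summable_on_cmult_left)
  have "emeasure (P_Geo a c1 c2 N) ?S
      = (\<integral>\<^sup>+L. ennreal (?Q L / Z_Geo a c1 c2 N) \<partial>count_space ?S)"
    unfolding P_Geo_def point_measure_def
    by (subst emeasure_density) (auto intro!: nn_integral_cong)
  also have "\<dots> = ennreal (infsetsum (\<lambda>L. ?Q L / Z_Geo a c1 c2 N) ?S)"
    using ab pos Z by (intro nn_integral_conv_infsetsum) (auto intro: less_imp_le)
  also have "infsetsum (\<lambda>L. ?Q L / Z_Geo a c1 c2 N) ?S = (\<Sum>\<^sub>\<infinity>L\<in>?S. ?Q L / Z_Geo a c1 c2 N)"
    using ab by (rule infsetsum_infsum)
  also have "\<dots> = Z_Geo a c1 c2 N / Z_Geo a c1 c2 N"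
    using sm unfolding divide_inverse Z_Geo_def by (intro infsum_cmult_left)
  finally show "emeasure (P_Geo a c1 c2 N) (space (P_Geo a c1 c2 N)) = 1"
    using Z by (simp add: P_Geo_def space_point_measure)
qed

end

theory Submission
  imports Defs
begin

text \<open>
  Put \<open>M = (MAX j. L2 j - L1 (j - 1))\<close>, \<open>p = L1 N + M\<close>, \<open>q = L2 N - M\<close> and \<open>l = L1 N\<close>. The partition
  \<open>(p, q)\<close> is the shape that RSK attaches to the two rows of increments, so \<open>q \<le> l \<le> p\<close>, and a
  Lindstroem-Gessel-Viennot count shows that the number of pairs with given \<open>(p, q, l)\<close> is
  \<open>h p * h q - h (p + 1) * h (q - 1)\<close> with \<open>h k = (N + k - 1) choose k\<close>, whatever \<open>l\<close> is. The weight
  of each of them is \<open>a^(p + q) * c1^(p - l) * c2^(l - q)\<close>.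

  With \<open>c = max 1 (max c1 c2)\<close> this is \<open>(a * c)^p * (a / c)^q * (c1 / c)^(p - l) * (c2 / c)^(l - q)\<close>.
  Up to polynomial factors in \<open>N\<close>, \<open>p\<close> and \<open>q\<close> thus behave like independent negative binomials with
  parameters \<open>a * c\<close> and \<open>a / c\<close>, and Chernoff bounds make \<open>p / N\<close> and \<open>q / N\<close> concentrate. If
  \<open>c = 1\<close> both limits agree and squeeze \<open>l / N\<close>; if \<open>c = c1 > c2\<close> the last factor pins \<open>l\<close> to \<open>q\<close>;
  if \<open>c = c2 > c1\<close> the third one pins \<open>l\<close> to \<open>p\<close>; if \<open>c1 = c2 > 1\<close>, then given \<open>(p, q)\<close> the law of
  \<open>l\<close> is uniform on \<open>{q..p}\<close>.
\<close>

section \<open>Counting pairs of paths\<close>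

text \<open>The number of paths of length \<open>N\<close> that end at \<open>k\<close>, that is,
  the complete homogeneous symmetric polynomial of degree \<open>k\<close> at \<open>N\<close> ones.
  For \<open>N = 0\<close> the truncated subtraction still gives the right values.\<close>

definition multichoose :: "nat \<Rightarrow> nat \<Rightarrow> nat" where
  "multichoose N k = (N + k - 1) choose k"

section \<open>Summation and absorption rules for multiset coefficients\<close>

lemma multichoose_0 [simp]: "multichoose N 0 = 1"
  by (simp add: multichoose_def)

lemma multichoose_0_left: "multichoose 0 k = (if k = 0 then 1 else 0)"
  by (simp add: multichoose_def binomial_eq_0)

lemma multichoose_Suc_Suc:
  "multichoose (Suc N) (Suc k) = multichoose (Suc N) k + multichoose N (Suc k)"
  by (simp add: multichoose_def)

text \<open>Pascal's rule makes the sum telescope. The shift is carried along because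
  \<open>card_noncrossing\<close> needs it with \<open>m\<close> and with 0 over the same half-open
  range.\<close>

lemma sum_multichoose_greaterThanAtMost:
  assumes "e \<le> l"
  shows "(\<Sum>i\<in>{e<..l}. int (multichoose N (i + m)))
    = int (multichoose (Suc N) (l + m)) - int (multichoose (Suc N) (e + m))"
  using assms
proof (induction l rule: dec_induct)
  case (step n)
  have "{e<..Suc n} = insert (Suc n) {e<..n}" using step by auto
  then show ?case using step by (simp add: multichoose_Suc_Suc)
qed auto

lemma sum_multichoose_atMost:
  "(\<Sum>i\<le>k. multichoose N i) = multichoose (Suc N) k"
  by (induction k) (simp_all add: multichoose_Suc_Suc)

text \<open>The guard matters: below \<open>m\<close> the truncated \<open>i - m\<close> is 0, and
  each such term would wrongly contribute 1.\<close>

lemma sum_multichoose_shift: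
  "(\<Sum>i\<le>k. if m \<le> i then multichoose N (i - m) else 0)
    = (if m \<le> k then multichoose (Suc N) (k - m) else 0)"
proof (induction k)
  case (Suc k)
  consider "m \<le> k" | "m = Suc k" | "m > Suc k" by linarith
  then show ?case
    using Suc by cases (auto simp: multichoose_Suc_Suc Suc_diff_le)
qed auto

lemma multichoose_absorb: "Suc k * multichoose N (Suc k) = (N + k) * multichoose N k"
proof (cases N)
  case (Suc r)
  show ?thesis
    using Suc_times_binomial_add[of k "r"] binomial_absorb_comp[of "Suc (r + k)" k] Suc
    by (simp add: multichoose_def algebra_simps)
qed (auto simp: multichoose_0_left)

text \<open>Trades a factor linear in \<open>k\<close> for one more in \<open>N\<close>, which later
  absorbs the number of admissible values of \<open>l\<close>. The induction step is
  \<open>multichoose_absorb\<close> for \<open>Suc N\<close> and for \<open>N\<close>, after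
  cancelling \<open>Suc k\<close>.\<close>

lemma multichoose_left_Suc: "N * multichoose (Suc N) k = (N + k) * multichoose N k"
proof (induction k)
  case (Suc k)
  have "Suc k * (N * multichoose (Suc N) (Suc k)) = N * ((Suc N + k) * multichoose (Suc N) k)"
    using multichoose_absorb[of k "Suc N"] by (simp add: algebra_simps)
  also have "\<dots> = (Suc N + k) * (N * multichoose (Suc N) k)"
    by (simp only: mult.left_commute)
  also have "\<dots> = (N + Suc k) * ((N + k) * multichoose N k)"
    unfolding Suc by simp
  also have "\<dots> = Suc k * ((N + Suc k) * multichoose N (Suc k))"
    using multichoose_absorb[of k N] by (simp add: algebra_simps)
  finally show ?case by (simp only: mult_cancel1) simp
qed auto

section \<open>Paths and their last steps\<close>

lemma paths_iff:
  "L \<in> paths N \<longleftrightarrow> L 0 = 0 \<and> (\<forall>j<N. L j \<le> L (Suc j)) \<and> (\<forall>j>N. L j = undefined)"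
proof
  assume "L \<in> paths N"
  then show "L 0 = 0 \<and> (\<forall>j<N. L j \<le> L (Suc j)) \<and> (\<forall>j>N. L j = undefined)"
    by (auto simp: paths_def path_of_def)
next
  assume *: "L 0 = 0 \<and> (\<forall>j<N. L j \<le> L (Suc j)) \<and> (\<forall>j>N. L j = undefined)"
  define m where "m = (\<lambda>k\<in>{1..N}. L k - L (k - 1))"
  have "(\<Sum>k=1..j. m k) = L j" if "j \<le> N" for j
    using that
  proof (induction j)
    case (Suc j)
    then show ?case using * by (auto simp: m_def)
  qed (use * in auto)
  then have "L = path_of N m"
    using * by (auto simp: path_of_def fun_eq_iff not_le)
  moreover have "m \<in> {1..N} \<rightarrow>\<^sub>E UNIV" by (auto simp: m_def)
  ultimately show "L \<in> paths N" by (auto simp: paths_def)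
qed

lemma path_0: "L \<in> paths N \<Longrightarrow> L 0 = 0"
  by (simp add: paths_iff)

lemma path_mono: "L \<in> paths N \<Longrightarrow> i \<le> j \<Longrightarrow> j \<le> N \<Longrightarrow> L i \<le> L j"
  by (auto simp: paths_def path_of_def intro!: sum_mono2)

text \<open>A path is \<open>undefined\<close> beyond \<open>N\<close>, so appending a last value is
  a function update, which \<open>path_restrict\<close> undoes.\<close>

lemma path_extend: "L \<in> paths N \<Longrightarrow> L N \<le> x \<Longrightarrow> L(Suc N := x) \<in> paths (Suc N)"
  by (auto simp: paths_iff less_Suc_eq)

lemma path_restrict: "L \<in> paths (Suc N) \<Longrightarrow> L(Suc N := undefined) \<in> paths N"
  by (auto simp: paths_iff)

text \<open>For \<open>N \<ge> 1\<close> the last condition says that the maximum of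
  \<open>L2 j - L1 (j - 1)\<close> is below \<open>m\<close>, written additively to stay in the
  naturals. Fixing both end points allows a recursion on the last step.\<close>

definition noncrossing ::
  "nat \<Rightarrow> nat \<Rightarrow> nat \<Rightarrow> nat \<Rightarrow> ((nat \<Rightarrow> nat) \<times> (nat \<Rightarrow> nat)) set" where
  "noncrossing N m l k = {L \<in> paths N \<times> paths N. fst L N = l \<and> snd L N = k \<and>
     (\<forall>j\<in>{1..N}. snd L j < m + fst L (j - 1))}"

text \<open>Deleting the last values leaves end points \<open>i\<close> and \<open>j\<close>. The
  only new constraint, at index \<open>Suc N\<close>, looks at the first path at time
  \<open>N\<close>, hence \<open>k < m + i\<close>; monotonicity gives \<open>i \<le> l\<close> and
  \<open>j \<le> k\<close>.\<close>

lemma noncrossing_Suc: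
  "noncrossing (Suc N) m l k = (\<lambda>(L1, L2). (L1(Suc N := l), L2(Suc N := k))) `
     (\<Union>(i, j)\<in>{i. i \<le> l \<and> k < m + i} \<times> {..k}. noncrossing N m i j)" (is "?A = ?f ` ?B")
proof
  show "?A \<subseteq> ?f ` ?B"
  proof
    fix L assume L: "L \<in> ?A"
    define L1 L2 where "L1 = fst L" and "L2 = snd L"
    have P: "L1 \<in> paths (Suc N)" "L2 \<in> paths (Suc N)"
      and E: "L1 (Suc N) = l" "L2 (Suc N) = k"
      and C: "\<forall>j\<in>{1..Suc N}. L2 j < m + L1 (j - 1)"
      using L by (auto simp: noncrossing_def L1_def L2_def)
    have "L1 N \<le> L1 (Suc N)" "L2 N \<le> L2 (Suc N)"
      using P by (auto intro: path_mono)
    then have ij: "(L1 N, L2 N) \<in> {i. i \<le> l \<and> k < m + i} \<times> {..k}"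
      using E bspec[OF C, of "Suc N"] by auto
    have "(L1(Suc N := undefined), L2(Suc N := undefined)) \<in> noncrossing N m (L1 N) (L2 N)"
      using P C by (auto simp: noncrossing_def path_restrict)
    with ij have "(L1(Suc N := undefined), L2(Suc N := undefined)) \<in> ?B" by blast
    moreover have "L = ?f (L1(Suc N := undefined), L2(Suc N := undefined))"
      using E by (auto simp: L1_def L2_def prod_eq_iff)
    ultimately show "L \<in> ?f ` ?B" by blast
  qed
  show "?f ` ?B \<subseteq> ?A"
    by (auto simp: noncrossing_def path_extend le_Suc_eq)
qed

lemma inj_on_path_extend:
  "inj_on (\<lambda>(L1, L2). (L1(Suc N := l), L2(Suc N := k))) (paths N \<times> paths N)"
proof (rule inj_on_inverseI[where g = "\<lambda>(L1, L2). (L1(Suc N := undefined), L2(Suc N := undefined))"])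
qed (auto simp: paths_iff fun_eq_iff)

lemma finite_noncrossing: "finite (noncrossing N m l k)"
proof (induction N arbitrary: l k)
  case 0
  have "noncrossing 0 m l k \<subseteq> {(\<lambda>j. if j = 0 then 0 else undefined, \<lambda>j. if j = 0 then 0 else undefined)}"
    by (auto simp: noncrossing_def paths_iff fun_eq_iff)
  then show ?case by (rule finite_subset) auto
next
  case (Suc N)
  have "finite {i. i \<le> l \<and> k < m + i}" by (rule finite_subset[of _ "{..l}"]) auto
  then show ?case unfolding noncrossing_Suc by (intro finite_imageI finite_UN_I) (auto simp: Suc)
qed

text \<open>
  The subtracted product counts the crossing pairs; it is what the Lindstroem-Gessel-Viennot
  swap of the two tails after the first crossing gives.
\<close>

lemma card_noncrossing:
  assumes "m \<ge> 1" "k \<le> l + m"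
  shows "int (card (noncrossing N m l k))
    = int (multichoose N l) * int (multichoose N k)
      - int (multichoose N (l + m)) * (if m \<le> k then int (multichoose N (k - m)) else 0)"
  using assms(2)
proof (induction N arbitrary: l k)
  case 0
  define u where "u = (\<lambda>j::nat. if j = 0 then 0 else undefined :: nat)"
  have "noncrossing 0 m l k = (if l = 0 \<and> k = 0 then {(u, u)} else {})"
    by (auto simp: noncrossing_def paths_iff fun_eq_iff u_def)
  then show ?case using assms(1) 0 by (auto simp: multichoose_0_left)
next
  case (Suc N)
  let ?I = "{i. i \<le> l \<and> k < m + i}"
  have fin: "finite ?I" by (rule finite_subset[of _ "{..l}"]) auto
  let ?h = "\<lambda>j. if m \<le> j then int (multichoose N (j - m)) else 0"
  have "card (noncrossing (Suc N) m l k)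
      = card (\<Union>(i, j)\<in>?I \<times> {..k}. noncrossing N m i j)"
    unfolding noncrossing_Suc
    by (intro card_image inj_on_subset[OF inj_on_path_extend]) (auto simp: noncrossing_def)
  also have "\<dots> = (\<Sum>(i, j)\<in>?I \<times> {..k}. card (noncrossing N m i j))"
  proof (subst card_UN_disjoint)
    show "\<forall>x\<in>?I \<times> {..k}. \<forall>y\<in>?I \<times> {..k}. x \<noteq> y \<longrightarrow>
      (case x of (i, j) \<Rightarrow> noncrossing N m i j) \<inter> (case y of (i, j) \<Rightarrow> noncrossing N m i j) = {}"
      by (auto simp: noncrossing_def)
  qed (use fin in \<open>auto simp: finite_noncrossing intro!: sum.cong\<close>)
  also have "\<dots> = (\<Sum>i\<in>?I. \<Sum>j\<le>k. card (noncrossing N m i j))"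
    by (simp add: sum.cartesian_product)
  finally have "int (card (noncrossing (Suc N) m l k))
      = (\<Sum>i\<in>?I. \<Sum>j\<le>k. int (card (noncrossing N m i j)))" by simp
  also have "\<dots> = (\<Sum>i\<in>?I. \<Sum>j\<le>k. int (multichoose N i) * int (multichoose N j)
      - int (multichoose N (i + m)) * ?h j)"
  \<comment> \<open>The induction hypothesis needs \<open>j \<le> i + m\<close>, which holds because
    \<open>j \<le> k < m + i\<close>.\<close>
  proof (intro sum.cong refl)
    fix i j assume "i \<in> ?I" "j \<in> {..k}"
    then show "int (card (noncrossing N m i j)) = int (multichoose N i) * int (multichoose N j)
      - int (multichoose N (i + m)) * ?h j"
      by (intro Suc.IH) auto
  qed
  also have "\<dots> = (\<Sum>i\<in>?I. int (multichoose N i)) * (\<Sum>j\<le>k. int (multichoose N j))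
      - (\<Sum>i\<in>?I. int (multichoose N (i + m))) * (\<Sum>j\<le>k. ?h j)"
    by (simp add: sum_subtractf sum_product)
  also have "(\<Sum>j\<le>k. int (multichoose N j)) = int (multichoose (Suc N) k)"
    by (simp flip: sum_multichoose_atMost)
  also have "(\<Sum>j\<le>k. ?h j) = (if m \<le> k then int (multichoose (Suc N) (k - m)) else 0)"
    using arg_cong[OF sum_multichoose_shift[of m N k], of int] by (simp add: if_distrib cong: if_cong)
  also have "(\<Sum>i\<in>?I. int (multichoose N i)) * int (multichoose (Suc N) k)
      - (\<Sum>i\<in>?I. int (multichoose N (i + m))) * (if m \<le> k then int (multichoose (Suc N) (k - m)) else 0)
     = int (multichoose (Suc N) l) * int (multichoose (Suc N) k)
      - int (multichoose (Suc N) (l + m)) * (if m \<le> k then int (multichoose (Suc N) (k - m)) else 0)"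
  proof (cases "m \<le> k")
    case False
    then have "?I = {..l}" by auto
    then show ?thesis using False by (simp flip: sum_multichoose_atMost)
  next
    case True
    \<comment> \<open>With \<open>k = m + e\<close> the lower ends of the two telescoped sums both
      yield the product of the coefficients at \<open>e\<close> and at \<open>k\<close>, with
      opposite signs, and so they cancel.\<close>
    then obtain e where e: "k = m + e" by (metis le_iff_add)
    then have I: "?I = {e<..l}" and el: "e \<le> l" using Suc.prems by auto
    show ?thesis
      using True unfolding I sum_multichoose_greaterThanAtMost[OF el, of N m]
        sum_multichoose_greaterThanAtMost[OF el, of N 0, simplified]
      by (simp add: e algebra_simps)
  qed
  finally show ?case .
qed

section \<open>The gap of a pair and the fibres of the shape map\<close>

definition gap :: "nat \<Rightarrow> (nat \<Rightarrow> nat) \<times> (nat \<Rightarrow> nat) \<Rightarrow> int" where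
  "gap N = (\<lambda>(L1, L2). MAX j\<in>{1..N}. int (L2 j) - int (L1 (j - 1)))"

text \<open>
  The shape of the two-row tableaux that RSK attaches to the pair, and the number of ones in it.
\<close>

definition shape :: "nat \<Rightarrow> (nat \<Rightarrow> nat) \<times> (nat \<Rightarrow> nat) \<Rightarrow> nat \<times> nat \<times> nat" where
  "shape N = (\<lambda>(L1, L2). (L1 N + nat (gap N (L1, L2)), L2 N - nat (gap N (L1, L2)), L1 N))"

text \<open>The dimension of the two-row Schur module of \<open>GL N\<close>, by the Jacobi-Trudi identity.\<close>

definition schur_dim :: "nat \<Rightarrow> nat \<Rightarrow> nat \<Rightarrow> int" where
  "schur_dim N p q = int (multichoose N p) * int (multichoose N q)
     - int (multichoose N (Suc p)) * (if q = 0 then 0 else int (multichoose N (q - 1)))"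

lemma gap_less_iff:
  assumes "N \<ge> 1"
  shows "gap N L < int m \<longleftrightarrow> (\<forall>j\<in>{1..N}. snd L j < m + fst L (j - 1))"
proof -
  have "gap N L < int m \<longleftrightarrow> (\<forall>j\<in>{1..N}. int (snd L j) - int (fst L (j - 1)) < int m)"
    unfolding gap_def case_prod_beta using assms by (subst Max_less_iff) auto
  also have "\<dots> \<longleftrightarrow> (\<forall>j\<in>{1..N}. snd L j < m + fst L (j - 1))"
    by (intro ball_cong refl) linarith
  finally show ?thesis .
qed

text \<open>The index 1 gives nonnegativity, since \<open>L1 0 = 0\<close>, and the index
  \<open>N\<close> gives the last bound. In terms of the shape the three bounds say
  \<open>l \<le> p\<close>, that the subtraction defining \<open>q\<close> does not truncate, and
  \<open>q \<le> l\<close>.\<close>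

lemma gap_bounds:
  assumes "N \<ge> 1" "L \<in> paths N \<times> paths N"
  shows "0 \<le> gap N L" "gap N L \<le> int (snd L N)" "int (snd L N) - int (fst L N) \<le> gap N L"
proof -
  have ge: "int (snd L j) - int (fst L (j - 1)) \<le> gap N L" if "j \<in> {1..N}" for j
    unfolding gap_def case_prod_beta using that by (intro Max_ge) auto
  show "0 \<le> gap N L"
    using ge[of 1] assms path_0[of "fst L" N] by auto
  show "int (snd L N) - int (fst L N) \<le> gap N L"
    using ge[of N] assms path_mono[of "fst L" N "N - 1" N] by auto
  have "snd L j \<le> snd L N" if "j \<in> {1..N}" for j
    using path_mono[of "snd L" N j N] assms(2) that by auto
  then have "gap N L < int (Suc (snd L N))"
    unfolding gap_less_iff[OF assms(1)] by (force simp: less_Suc_eq_le)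
  then show "gap N L \<le> int (snd L N)" by linarith
qed

lemma shape_bounds:
  assumes "N \<ge> 1" "L \<in> paths N \<times> paths N" "shape N L = (p, q, l)"
  shows "q \<le> l" "l \<le> p"
  using gap_bounds[OF assms(1,2)] assms(3) by (auto simp: shape_def split: prod.splits)

text \<open>A gap equal to \<open>p - l\<close> is one below \<open>Suc (p - l)\<close> but not
  below \<open>p - l\<close>, so each fibre is a difference of sets that
  \<open>card_noncrossing\<close> can count.\<close>

lemma shape_fibre:
  assumes "N \<ge> 1" "q \<le> l" "l \<le> p"
  shows "{L \<in> paths N \<times> paths N. shape N L = (p, q, l)}
    = noncrossing N (Suc (p - l)) l (q + (p - l)) - noncrossing N (p - l) l (q + (p - l))"
    (is "?A = ?B")
proof -
  have "L \<in> ?A \<longleftrightarrow> L \<in> ?B" for L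
  proof (cases "L \<in> paths N \<times> paths N")
    case True
    have "shape N L = (p, q, l) \<longleftrightarrow>
        fst L N = l \<and> snd L N = q + (p - l) \<and> gap N L = int (p - l)"
      using gap_bounds[OF assms(1) True] assms(2,3)
      by (auto simp: shape_def split: prod.splits)
    moreover have "gap N L = int (p - l) \<longleftrightarrow>
        gap N L < int (Suc (p - l)) \<and> \<not> gap N L < int (p - l)"
      by auto
    ultimately show ?thesis
      using True unfolding gap_less_iff[OF assms(1)] by (auto simp: noncrossing_def)
  qed (auto simp: noncrossing_def)
  then show ?thesis by blast
qed

lemma finite_shape_fibre:
  assumes "N \<ge> 1"
  shows "finite {L \<in> paths N \<times> paths N. shape N L = (p, q, l)}"
proof (cases "q \<le> l \<and> l \<le> p")
  case True
  then show ?thesis using shape_fibre[OF assms, of q l p] by (simp add: finite_noncrossing)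
next
  case False
  then have "{L \<in> paths N \<times> paths N. shape N L = (p, q, l)} = {}"
    using shape_bounds[OF assms] by blast
  then show ?thesis by (simp only: finite.emptyI)
qed

text \<open>Both counts start with the same product, the only place where \<open>l\<close> enters.
  It cancels in the difference, and the two subtracted products depend on \<open>p\<close> and
  \<open>q\<close> alone.\<close>

lemma card_shape_fibre:
  assumes "N \<ge> 1" "q \<le> l" "l \<le> p"
  shows "int (card {L \<in> paths N \<times> paths N. shape N L = (p, q, l)}) = schur_dim N p q"
proof -
  define v k where "v = p - l" and "k = q + v"
  have sub: "noncrossing N v l k \<subseteq> noncrossing N (Suc v) l k"
    by (auto simp: noncrossing_def less_Suc_eq)
  then have "int (card {L \<in> paths N \<times> paths N. shape N L = (p, q, l)})
      = int (card (noncrossing N (Suc v) l k)) - int (card (noncrossing N v l k))"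
    using finite_noncrossing[of N "Suc v" l k] finite_noncrossing[of N v l k]
    by (simp add: shape_fibre[OF assms] v_def k_def card_Diff_subset of_nat_diff card_mono)
  also have "int (card (noncrossing N (Suc v) l k)) = int (multichoose N l) * int (multichoose N k)
      - int (multichoose N (Suc p)) * (if q = 0 then 0 else int (multichoose N (q - 1)))"
    using assms by (subst card_noncrossing) (auto simp: v_def k_def)
  also have "int (card (noncrossing N v l k)) = int (multichoose N l) * int (multichoose N k)
      - int (multichoose N p) * int (multichoose N q)"
  \<comment> \<open>\<open>card_noncrossing\<close> requires a positive shift. At shift 0 the set is
    empty, as \<open>L2 1 < L1 0 = 0\<close> is impossible, and the claimed value is 0 too because
    then \<open>l = p\<close> and \<open>k = q\<close>.\<close>
  proof (cases "v = 0")
    case True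
    have "noncrossing N 0 l k = {}"
    proof (rule equals0I)
      fix L assume "L \<in> noncrossing N 0 l k"
      then have "\<forall>j\<in>{1..N}. snd L j < fst L (j - 1)" "fst L \<in> paths N"
        by (auto simp: noncrossing_def)
      then show False using assms(1) path_0[of "fst L" N] by (force dest: bspec[of _ _ 1])
    qed
    then show ?thesis using True assms by (simp add: v_def k_def)
  next
    case False
    then show ?thesis using assms by (subst card_noncrossing) (auto simp: v_def k_def)
  qed
  finally show ?thesis by (simp add: schur_dim_def)
qed

text \<open>Absorption turns the neighbours at \<open>p + 1\<close> and \<open>q - 1\<close> into
  multiples of the coefficients at \<open>p\<close> and \<open>q\<close>. The result is Weyl's
  dimension formula with denominators cleared; it makes the determinant comparable to its leading
  product.\<close>

lemma schur_dim_product: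
  assumes "q \<le> p"
  shows "(int p + 1) * (int N + int q - 1) * schur_dim N p q
    = int (multichoose N p) * int (multichoose N q) * (int p - int q + 1) * (int N - 1)"
proof -
  have 1: "(int p + 1) * int (multichoose N (Suc p)) = (int N + int p) * int (multichoose N p)"
    using arg_cong[OF multichoose_absorb[of p N], of int] by (simp add: algebra_simps)
  have 2: "(int N + int q - 1) * (if q = 0 then 0 else int (multichoose N (q - 1)))
      = int q * int (multichoose N q)"
    using arg_cong[OF multichoose_absorb[of "q - 1" N], of int]
    by (cases q) (simp_all add: algebra_simps)
  have "(int p + 1) * (int N + int q - 1) * schur_dim N p q
    = (int p + 1) * (int N + int q - 1) * (int (multichoose N p) * int (multichoose N q))
      - ((int p + 1) * int (multichoose N (Suc p)))
        * ((int N + int q - 1) * (if q = 0 then 0 else int (multichoose N (q - 1))))"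
    by (simp add: schur_dim_def algebra_simps)
  also have "\<dots> = int (multichoose N p) * int (multichoose N q) * (int p - int q + 1) * (int N - 1)"
    unfolding 1 2 by (simp add: algebra_simps)
  finally show ?thesis .
qed

lemma schur_dim_le: "schur_dim N p q \<le> int (multichoose N p) * int (multichoose N q)"
  by (simp add: schur_dim_def)

section \<open>The law of the shape\<close>

text \<open>The unnormalised mass of a fibre. The guard is there because outside
  \<open>q \<le> l \<le> p\<close> the fibre is empty while the formula need not vanish.\<close>

definition shape_mass :: "real \<Rightarrow> real \<Rightarrow> real \<Rightarrow> nat \<Rightarrow> nat \<times> nat \<times> nat \<Rightarrow> real" where
  "shape_mass a c1 c2 N = (\<lambda>(p, q, l). if q \<le> l \<and> l \<le> p
     then a ^ (p + q) * c1 ^ (p - l) * c2 ^ (l - q) * real_of_int (schur_dim N p q) else 0)"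

lemma Q_weight_shape:
  assumes "N \<ge> 1" "L \<in> paths N \<times> paths N" "shape N L = (p, q, l)" "c2 > 0"
  shows "Q_weight a c1 c2 N L = a ^ (p + q) * c1 ^ (p - l) * c2 ^ (l - q)"
proof -
  obtain L1 L2 where L: "L = (L1, L2)" by (cases L)
  define v where "v = nat (gap N L)"
  have v: "gap N L = int v"
    using gap_bounds[OF assms(1,2)] by (simp add: v_def)
  have "p = L1 N + v" "q = L2 N - v" "l = L1 N"
    using assms(3) by (auto simp: L shape_def v_def)
  moreover have "v \<le> snd L N"
    using gap_bounds(2)[OF assms(1,2)] v by linarith
  ultimately have e: "L1 N = l" "L2 N = q + v" "p = l + v" by (auto simp: L)
  have ql: "q \<le> l" using shape_bounds[OF assms(1-3)] by simp
  have "Q_weight a c1 c2 N L = a ^ l * a ^ (q + v) * (c1 * c2) powi int v * c2 powi (int l - int (q + v))"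
    unfolding v[symmetric] by (simp add: Q_weight_def gap_def L e)
  \<comment> \<open>The exponent may be negative. Splitting off \<open>v\<close> leaves a division
    by \<open>c2 ^ v\<close>, which cancels against the \<open>c2\<close> part of
    \<open>(c1 * c2) ^ v\<close>.\<close>
  also have "c2 powi (int l - int (q + v)) = c2 powi (int (l - q) - int v)"
    using ql by (simp add: of_nat_diff algebra_simps)
  also have "\<dots> = c2 ^ (l - q) / c2 ^ v"
    using assms(4) by (simp add: power_int_diff)
  finally show ?thesis
    using assms(4) ql e by (simp add: power_mult_distrib power_add)
qed

section \<open>Pushing the measure forward to shapes\<close>

lemma measurable_shape: "shape N \<in> measurable (P_Geo a c1 c2 N) (count_space UNIV)"
  by (simp add: P_Geo_def measurable_def space_point_measure sets_point_measure)

lemma space_P_Geo: "space (P_Geo a c1 c2 N) = paths N \<times> paths N"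
  by (simp add: P_Geo_def space_point_measure)

lemma sets_P_Geo: "sets (P_Geo a c1 c2 N) = Pow (paths N \<times> paths N)"
  by (simp add: P_Geo_def sets_point_measure)

locale geo =
  fixes a c1 c2 :: real
  assumes a: "0 < a" "a < 1"
    and c1: "0 < c1" "a * c1 < 1"
    and c2: "0 < c2" "a * c2 < 1"
begin

lemma prob_space_P: "N \<ge> 1 \<Longrightarrow> prob_space (P_Geo a c1 c2 N)"
  using a c1 c2 by (intro prob_space_P_Geo) (auto simp: field_simps)

text \<open>Read off from the total mass 1: if the normaliser were not positive, every density value
  would be at most 0 (division by 0 gives 0), \<open>ennreal\<close> would send it to 0, and the
  measure would vanish.\<close>

lemma Z_pos:
  assumes "N \<ge> 1"
  shows "Z_Geo a c1 c2 N > 0"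
proof (rule ccontr)
  assume "\<not> Z_Geo a c1 c2 N > 0"
  then have "ennreal (Q_weight a c1 c2 N L / Z_Geo a c1 c2 N) = 0" for L
    using less_imp_le[OF Q_weight_pos[of a c1 c2 N L]] a c1 c2
    by (auto intro!: divide_nonneg_nonpos ennreal_neg simp: not_less)
  then have "emeasure (P_Geo a c1 c2 N) (space (P_Geo a c1 c2 N)) = 0"
    by (simp add: P_Geo_def point_measure_def emeasure_density space_point_measure)
  then show False
    using prob_space.emeasure_space_1[OF prob_space_P[OF assms]] by simp
qed

lemma shape_mass_nonneg:
  assumes "N \<ge> 1"
  shows "0 \<le> shape_mass a c1 c2 N t"
proof -
  obtain p q l where t: "t = (p, q, l)" by (cases t)
  show ?thesis
  proof (cases "q \<le> l \<and> l \<le> p")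
    case True
    then have "0 \<le> schur_dim N p q" using card_shape_fibre[OF assms, of q l p] by linarith
    then show ?thesis using a c1 c2 by (simp add: shape_mass_def t)
  qed (auto simp: shape_mass_def t)
qed

text \<open>All pairs in a fibre have the same weight, so its mass is this weight times the
  cardinality of the finite fibre.\<close>

lemma emeasure_shape_singleton:
  assumes "N \<ge> 1"
  shows "emeasure (P_Geo a c1 c2 N) {L \<in> paths N \<times> paths N. shape N L = t}
    = ennreal (shape_mass a c1 c2 N t / Z_Geo a c1 c2 N)"
proof -
  obtain p q l where t: "t = (p, q, l)" by (cases t)
  let ?A = "{L \<in> paths N \<times> paths N. shape N L = t}"
  have fin: "finite ?A" unfolding t by (rule finite_shape_fibre[OF assms])
  let ?w = "a ^ (p + q) * c1 ^ (p - l) * c2 ^ (l - q) / Z_Geo a c1 c2 N"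
  have w: "0 \<le> ?w" using a c1 c2 Z_pos[OF assms] by simp
  have "emeasure (P_Geo a c1 c2 N) ?A = (\<Sum>L\<in>?A. ennreal (Q_weight a c1 c2 N L / Z_Geo a c1 c2 N))"
    unfolding P_Geo_def using fin by (intro emeasure_point_measure_finite2) auto
  also have "\<dots> = (\<Sum>L\<in>?A. ennreal ?w)"
    using Q_weight_shape[OF assms] c2 by (intro sum.cong refl) (auto simp: t)
  also have "\<dots> = of_nat (card ?A) * ennreal ?w"
    by (rule sum_constant)
  also have "\<dots> = ennreal (real (card ?A)) * ennreal ?w"
    by (simp only: ennreal_of_nat_eq_real_of_nat)
  also have "\<dots> = ennreal (real (card ?A) * ?w)"
    by (rule ennreal_mult[symmetric, OF of_nat_0_le_iff w])
  also have "real (card ?A) * ?w = shape_mass a c1 c2 N t / Z_Geo a c1 c2 N"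
  proof (cases "q \<le> l \<and> l \<le> p")
    case True
    have "real (card ?A) = real_of_int (int (card ?A))"
      by (rule of_int_of_nat_eq[symmetric])
    also have "int (card ?A) = schur_dim N p q"
      unfolding t using True by (intro card_shape_fibre assms) auto
    finally have eq: "real (card ?A) = real_of_int (schur_dim N p q)" .
    show ?thesis unfolding eq using True by (simp add: shape_mass_def t)
  next
    case False
    then have "?A = {}" using shape_bounds[OF assms] unfolding t by blast
    then have "card ?A = 0" by (simp only: card.empty)
    moreover have "shape_mass a c1 c2 N t = 0" using False by (auto simp: shape_mass_def t)
    ultimately show ?thesis by (simp only: of_nat_0 mult_zero_left div_0)
  qed
  finally show ?thesis .
qed

lemma emeasure_shape:
  assumes "N \<ge> 1"
  shows "emeasure (P_Geo a c1 c2 N) {L \<in> paths N \<times> paths N. shape N L \<in> B}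
    = (\<integral>\<^sup>+t. ennreal (shape_mass a c1 c2 N t / Z_Geo a c1 c2 N) * indicator B t \<partial>count_space UNIV)"
proof -
  let ?D = "distr (P_Geo a c1 c2 N) (count_space UNIV) (shape N)"
  have D: "emeasure ?D X = emeasure (P_Geo a c1 c2 N) {L \<in> paths N \<times> paths N. shape N L \<in> X}" for X
    by (subst emeasure_distr[OF measurable_shape])
      (auto simp: space_P_Geo intro!: arg_cong2[where f = emeasure])
  have "emeasure ?D B = (\<integral>\<^sup>+t. emeasure ?D {t} \<partial>count_space B)"
    by (rule emeasure_countable_singleton) auto
  also have "\<dots> = (\<integral>\<^sup>+t. emeasure ?D {t} * indicator B t \<partial>count_space UNIV)"
    by (subst nn_integral_count_space_indicator) auto
  finally show ?thesis
    unfolding D by (simp add: emeasure_shape_singleton[OF assms])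
qed

text \<open>A single shape has probability at most 1. Used in \<open>Z_lower\<close> to bound the
  normaliser from below.\<close>

lemma shape_mass_le_Z:
  assumes "N \<ge> 1"
  shows "shape_mass a c1 c2 N t \<le> Z_Geo a c1 c2 N"
proof -
  interpret prob_space "P_Geo a c1 c2 N" by (rule prob_space_P[OF assms])
  have "ennreal (shape_mass a c1 c2 N t / Z_Geo a c1 c2 N) \<le> 1"
    unfolding emeasure_shape_singleton[OF assms, symmetric] by (rule emeasure_le_1)
  then show ?thesis using Z_pos[OF assms] by (simp add: ennreal_le_1)
qed

end

section \<open>Negative binomial distributions\<close>

text \<open>The law of a sum of \<open>N\<close> independent geometric variables with weights
  \<open>(1 - q) * q ^ k\<close>; its mean is \<open>N * q / (1 - q)\<close>.\<close>

definition neg_binom :: "real \<Rightarrow> nat \<Rightarrow> nat \<Rightarrow> real" where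
  "neg_binom q N k = q ^ k * real (multichoose N k) * (1 - q) ^ N"

lemma neg_binom_nonneg: "0 \<le> q \<Longrightarrow> q \<le> 1 \<Longrightarrow> 0 \<le> neg_binom q N k"
  by (simp add: neg_binom_def)

lemma multichoose_sums:
  fixes x :: real
  assumes "\<bar>x\<bar> < 1"
  shows "(\<lambda>k. real (multichoose N k) * x ^ k) sums (1 / (1 - x) ^ N)"
proof -
  have "(\<lambda>k. (- real N gchoose k) * (- x) ^ k) sums (1 + (- x)) powr (- real N)"
    using assms by (intro gen_binomial_real) auto
  moreover have "(1 + (- x)) powr (- real N) = 1 / (1 - x) ^ N"
    using assms by (simp add: powr_minus powr_realpow divide_inverse)
  moreover have "(- real N gchoose k) * (- x) ^ k = real (multichoose N k) * x ^ k" for k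
  \<comment> \<open>In the excluded case \<open>N + k - 1\<close> truncates to 0, whereas its real
    counterpart is -1.\<close>
  proof (cases "N = 0 \<and> k = 0")
    case False
    have "(- real N gchoose k) = (- 1) ^ k * ((real N + real k - 1) gchoose k)"
      by (rule gbinomial_minus)
    also have "real N + real k - 1 = real (N + k - 1)"
      using False by (auto simp: of_nat_diff)
    also have "(real (N + k - 1) gchoose k) = real (multichoose N k)"
      by (simp add: multichoose_def binomial_gbinomial)
    finally show ?thesis by (simp add: power_minus[of x])
  qed auto
  ultimately show ?thesis by simp
qed

section \<open>Generating function and exponential tail bounds\<close>

lemma nn_integral_neg_binom_pgf:
  assumes "0 < q" "q < 1" "0 \<le> t" "q * t < 1"
  shows "(\<integral>\<^sup>+k. ennreal (neg_binom q N k * t ^ k) \<partial>count_space UNIV)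
    = ennreal (((1 - q) / (1 - q * t)) ^ N)"
proof -
  have "(\<lambda>k. (1 - q) ^ N * (real (multichoose N k) * (q * t) ^ k)) sums
      ((1 - q) ^ N * (1 / (1 - q * t) ^ N))"
    using assms by (intro sums_mult multichoose_sums) auto
  then have "(\<lambda>k. neg_binom q N k * t ^ k) sums (((1 - q) / (1 - q * t)) ^ N)"
    by (simp add: neg_binom_def power_mult_distrib power_divide mult_ac)
  then have "(\<Sum>k. ennreal (neg_binom q N k * t ^ k)) = ennreal (((1 - q) / (1 - q * t)) ^ N)"
    using assms by (intro suminf_ennreal_eq) (auto intro!: mult_nonneg_nonneg neg_binom_nonneg)
  then show ?thesis by (simp add: nn_integral_count_space_nat)
qed

lemma nn_integral_neg_binom:
  assumes "0 < q" "q < 1"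
  shows "(\<integral>\<^sup>+k. ennreal (neg_binom q N k) \<partial>count_space UNIV) = 1"
  using nn_integral_neg_binom_pgf[of q 1 N] assms by simp

text \<open>Since \<open>N \<ge> 1\<close>, the factor is at most \<open>N + k\<close>, which
  \<open>multichoose_left_Suc\<close> absorbs; \<open>1 / (1 - q)\<close> corrects the
  normalisation. The weight \<open>k + 1\<close> will stand for the number of values of
  \<open>l\<close> below a given \<open>p\<close>.\<close>

lemma Suc_times_neg_binom_le:
  assumes "0 < q" "q < 1" "N \<ge> 1"
  shows "(real k + 1) * neg_binom q N k \<le> real N / (1 - q) * neg_binom q (Suc N) k"
proof -
  have "(real k + 1) * real (multichoose N k) \<le> (real N + real k) * real (multichoose N k)"
    using assms by (intro mult_right_mono) auto
  also have "\<dots> = real N * real (multichoose (Suc N) k)"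
    using arg_cong[OF multichoose_left_Suc[of N k], of real] by simp
  finally have "((real k + 1) * real (multichoose N k)) * (q ^ k * (1 - q) ^ N)
      \<le> (real N * real (multichoose (Suc N) k)) * (q ^ k * (1 - q) ^ N)"
    using assms by (intro mult_right_mono) auto
  then show ?thesis using assms by (simp add: neg_binom_def mult_ac)
qed

lemma nn_integral_Suc_times_neg_binom_le:
  assumes "0 < q" "q < 1" "N \<ge> 1"
  shows "(\<integral>\<^sup>+k. ennreal ((real k + 1) * neg_binom q N k) \<partial>count_space UNIV)
    \<le> ennreal (real N / (1 - q))"
proof -
  have "(\<integral>\<^sup>+k. ennreal ((real k + 1) * neg_binom q N k) \<partial>count_space UNIV)
    \<le> (\<integral>\<^sup>+k. ennreal (real N / (1 - q)) * ennreal (neg_binom q (Suc N) k) \<partial>count_space UNIV)"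
    using assms Suc_times_neg_binom_le[OF assms]
    by (intro nn_integral_mono) (simp add: neg_binom_nonneg flip: ennreal_mult)
  also have "\<dots> = ennreal (real N / (1 - q))"
    using nn_integral_neg_binom[OF assms(1,2), of "Suc N"] by (simp add: nn_integral_cmult)
  finally show ?thesis .
qed

text \<open>The logarithm of the Chernoff base, as a function of \<open>t\<close>, vanishes at
  \<open>t = 1\<close> and has derivative \<open>- s\<close> there. A small move of \<open>t\<close>
  away from 1 in the direction of the sign of \<open>s\<close> therefore makes it negative.\<close>

lemma cramer_base_exists:
  assumes "0 < q" "q < 1" "s \<noteq> (0::real)" "s < 0 \<Longrightarrow> q / (1 - q) + s > 0"
  shows "\<exists>t>0. q * t < 1 \<and> s * (t - 1) > 0
    \<and> t powr (- (q / (1 - q) + s)) * ((1 - q) / (1 - q * t)) < 1"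
proof -
  define v where "v = q / (1 - q)"
  define \<phi> where "\<phi> = (\<lambda>t. - (v + s) * ln t + ln (1 - q) - ln (1 - q * t))"
  have D: "(\<phi> has_real_derivative - s) (at 1)"
    unfolding \<phi>_def using assms
    by (auto intro!: derivative_eq_intros simp: v_def)
  have phi1: "\<phi> 1 = 0" by (simp add: \<phi>_def)
  \<comment> \<open>Keeps \<open>t\<close> positive and \<open>q * t < 1\<close> on both sides of
    1.\<close>
  define \<delta> where "\<delta> = min 1 (1 / q - 1) / 2"
  have d: "\<delta> > 0" "\<delta> < 1" "q * (1 + \<delta>) < 1"
  proof -
    show "\<delta> > 0" "\<delta> < 1" using assms by (auto simp: \<delta>_def)
    have "\<delta> < 1 / q - 1" using assms by (auto simp: \<delta>_def min_def field_simps)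
    then show "q * (1 + \<delta>) < 1" using assms by (simp add: field_simps)
  qed
  have "\<exists>t>0. q * t < 1 \<and> s * (t - 1) > 0 \<and> \<phi> t < 0"
  proof (cases "s > 0")
    case True
    then obtain e where e: "e > 0" "\<And>h. 0 < h \<Longrightarrow> h < e \<Longrightarrow> \<phi> (1 + h) < \<phi> 1"
      using DERIV_neg_dec_right[OF D] by auto
    define h where "h = min \<delta> (e / 2)"
    have h: "0 < h" "h < e" "h \<le> \<delta>" using e d by (auto simp: h_def)
    have "q * (1 + h) \<le> q * (1 + \<delta>)" using assms h by (intro mult_left_mono) auto
    then show ?thesis
      using e(2)[of h] h True d phi1 by (intro exI[of _ "1 + h"]) auto
  next
    case False
    then have "s < 0" using assms by auto
    then obtain e where e: "e > 0" "\<And>h. 0 < h \<Longrightarrow> h < e \<Longrightarrow> \<phi> (1 - h) < \<phi> 1"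
      using DERIV_pos_inc_left[OF D] by auto
    define h where "h = min \<delta> (e / 2)"
    have h: "0 < h" "h < e" "h \<le> \<delta>" using e d by (auto simp: h_def)
    have "q * (1 - h) \<le> q * 1" using assms h by (intro mult_left_mono) auto
    then have "q * (1 - h) < 1" using assms by linarith
    moreover have "s * (1 - h - 1) > 0" using h \<open>s < 0\<close> by (auto simp: mult_less_0_iff)
    ultimately show ?thesis
      using e(2)[of h] h d phi1 by (intro exI[of _ "1 - h"]) auto
  qed
  then obtain t where t: "t > 0" "q * t < 1" "s * (t - 1) > 0" "\<phi> t < 0" by blast
  have "t powr (- (v + s)) * ((1 - q) / (1 - q * t)) = exp (\<phi> t)"
    using t assms by (simp add: \<phi>_def exp_add exp_diff powr_def)
  also have "\<dots> < 1" using t by simp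
  finally show ?thesis using t unfolding v_def by blast
qed

text \<open>Chernoff's bound; both signs of \<open>s\<close> are needed, one for each tail.\<close>

lemma neg_binom_tail:
  assumes "0 < q" "q < 1" "s \<noteq> (0::real)" "s < 0 \<Longrightarrow> q / (1 - q) + s > 0"
  shows "\<exists>C r. 0 < r \<and> r < 1 \<and> C \<ge> 0 \<and> (\<forall>N\<ge>1.
    (\<integral>\<^sup>+k. ennreal ((real k + 1) * neg_binom q N k)
        * indicator {k. s * (real k - (q / (1 - q) + s) * real N) \<ge> 0} k \<partial>count_space UNIV)
      \<le> ennreal (C * real N * r ^ N))"
proof -
  define u where "u = q / (1 - q) + s"
  obtain t where t: "t > 0" "q * t < 1" "s * (t - 1) > 0"
    and r1: "t powr (- u) * ((1 - q) / (1 - q * t)) < 1"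
    using cramer_base_exists[OF assms] unfolding u_def by blast
  define r where "r = t powr (- u) * ((1 - q) / (1 - q * t))"
  have r0: "r > 0" using t assms by (simp add: r_def)
  \<comment> \<open>The generating function is used at \<open>Suc N\<close>; its surplus factor
    \<open>(1 - q) / (1 - q * t)\<close> times the \<open>1 / (1 - q)\<close> of
    \<open>Suc_times_neg_binom_le\<close> is this constant.\<close>
  define C where "C = 1 / (1 - q * t)"
  have C0: "C \<ge> 0" using t by (simp add: C_def)
  have "(\<integral>\<^sup>+k. ennreal ((real k + 1) * neg_binom q N k)
        * indicator {k. s * (real k - u * real N) \<ge> 0} k \<partial>count_space UNIV)
      \<le> ennreal (C * real N * r ^ N)" if N: "N \<ge> 1" for N
  proof -
    define K where "K = real N / (1 - q) * t powr (- u * real N)"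
    have K: "K \<ge> 0" using assms by (simp add: K_def)
    have "(\<integral>\<^sup>+k. ennreal ((real k + 1) * neg_binom q N k)
        * indicator {k. s * (real k - u * real N) \<ge> 0} k \<partial>count_space UNIV)
      \<le> (\<integral>\<^sup>+k. ennreal K * ennreal (neg_binom q (Suc N) k * t ^ k) \<partial>count_space UNIV)"
    proof (rule nn_integral_mono)
      fix k
      show "ennreal ((real k + 1) * neg_binom q N k) * indicator {k. s * (real k - u * real N) \<ge> 0} k
        \<le> ennreal K * ennreal (neg_binom q (Suc N) k * t ^ k)"
      proof (cases "s * (real k - u * real N) \<ge> 0")
        case True
        \<comment> \<open>On the event the exponent vanishes or has the sign of \<open>s\<close>,
          which is also the sign of \<open>t - 1\<close>. Inserting this weight is Markov's
          inequality.\<close>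
        have "1 \<le> t powr (real k - u * real N)"
        proof (cases "s > 0")
          case True
          then have "real k - u * real N \<ge> 0" "t \<ge> 1"
            using \<open>s * (real k - u * real N) \<ge> 0\<close> t by (auto simp: zero_le_mult_iff zero_less_mult_iff)
          then show ?thesis by (rule ge_one_powr_ge_zero[rotated])
        next
          case False
          then have "real k - u * real N \<le> 0" "t \<le> 1"
            using \<open>s * (real k - u * real N) \<ge> 0\<close> t assms
            by (auto simp: zero_le_mult_iff zero_less_mult_iff)
          then have "1 powr (real k - u * real N) \<le> t powr (real k - u * real N)"
            using t by (intro powr_mono2') auto
          then show ?thesis by simp
        qed
        also have "\<dots> = t powr (- u * real N) * t ^ k"
          using t by (simp add: powr_diff powr_minus powr_realpow divide_inverse)
        finally have one: "1 \<le> t powr (- u * real N) * t ^ k" .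
        define A where "A = real N / (1 - q) * neg_binom q (Suc N) k"
        have "A \<ge> 0" using assms by (simp add: A_def neg_binom_nonneg)
        then have "A * 1 \<le> A * (t powr (- u * real N) * t ^ k)"
          using one by (rule mult_left_mono[rotated])
        then have "(real k + 1) * neg_binom q N k \<le>
            (real N / (1 - q) * neg_binom q (Suc N) k) * (t powr (- u * real N) * t ^ k)"
          using Suc_times_neg_binom_le[OF assms(1,2) N, of k] unfolding A_def by linarith
        then show ?thesis
          using True K t assms by (simp add: K_def neg_binom_nonneg mult_ac flip: ennreal_mult)
      qed simp
    qed
    also have "\<dots> = ennreal K * ennreal (((1 - q) / (1 - q * t)) ^ Suc N)"
      using assms t by (simp add: nn_integral_cmult nn_integral_neg_binom_pgf)
    also have "\<dots> = ennreal (K * ((1 - q) / (1 - q * t)) ^ Suc N)"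
      using K assms t by (simp flip: ennreal_mult)
    also have "K * ((1 - q) / (1 - q * t)) ^ Suc N = C * real N * r ^ N"
    proof -
      have "t powr (- u * real N) = (t powr (- u)) ^ N"
        using t by (simp add: powr_powr flip: powr_realpow)
      moreover have "r ^ N = (t powr (- u)) ^ N * ((1 - q) / (1 - q * t)) ^ N"
        by (simp only: r_def power_mult_distrib)
      ultimately show ?thesis
        using assms by (simp add: K_def C_def)
    qed
    finally show ?thesis .
  qed
  then show ?thesis using r0 r1 C0 unfolding r_def u_def by blast
qed

lemma neg_binom_concentration:
  assumes "0 < q" "q < 1" "\<epsilon> > 0"
  shows "\<exists>C r. 0 < r \<and> r < 1 \<and> C \<ge> 0 \<and> (\<forall>N\<ge>1.
    (\<integral>\<^sup>+k. ennreal ((real k + 1) * neg_binom q N k)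
        * indicator {k. \<bar>real k - q / (1 - q) * real N\<bar> > \<epsilon> * real N} k \<partial>count_space UNIV)
      \<le> ennreal (C * real N * r ^ N))"
proof -
  define v where "v = q / (1 - q)"
  have v: "v > 0" using assms by (simp add: v_def)
  \<comment> \<open>The cap at \<open>v / 2\<close> keeps \<open>v - s\<close> positive, as the
    lower tail requires.\<close>
  define s where "s = min \<epsilon> (v / 2)"
  have s: "s > 0" "s \<le> \<epsilon>" "s < v" using assms v by (auto simp: s_def)
  define I where "I = (\<lambda>N A. \<integral>\<^sup>+k. ennreal ((real k + 1) * neg_binom q N k) * indicator A k \<partial>count_space UNIV)"
  define U where "U = (\<lambda>s N. {k. s * (real k - (v + s) * real N) \<ge> 0})"
  have "\<exists>C r. 0 < r \<and> r < 1 \<and> C \<ge> 0 \<and> (\<forall>N\<ge>1. I N (U s N) \<le> ennreal (C * real N * r ^ N))"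
    unfolding I_def U_def v_def using assms s by (intro neg_binom_tail) auto
  moreover have "\<exists>C r. 0 < r \<and> r < 1 \<and> C \<ge> 0 \<and> (\<forall>N\<ge>1. I N (U (- s) N) \<le> ennreal (C * real N * r ^ N))"
    unfolding I_def U_def v_def using assms s by (intro neg_binom_tail) (auto simp: v_def)
  ultimately obtain C1 r1 C2 r2 where C: "C1 \<ge> 0" "C2 \<ge> 0" and r: "0 < r1" "r1 < 1" "0 < r2" "r2 < 1"
    and I: "\<And>N. N \<ge> 1 \<Longrightarrow> I N (U s N) \<le> ennreal (C1 * real N * r1 ^ N)"
      "\<And>N. N \<ge> 1 \<Longrightarrow> I N (U (- s) N) \<le> ennreal (C2 * real N * r2 ^ N)" by blast
  have "I N {k. \<bar>real k - v * real N\<bar> > \<epsilon> * real N} \<le> ennreal ((C1 + C2) * real N * max r1 r2 ^ N)"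
    if N: "N \<ge> 1" for N
  proof -
    have "k \<in> U s N \<or> k \<in> U (- s) N" if k: "\<bar>real k - v * real N\<bar> > \<epsilon> * real N" for k
    proof -
      have "s * real N \<le> \<epsilon> * real N" using s by (intro mult_right_mono) auto
      then have "real k - (v + s) * real N \<ge> 0 \<or> real k - (v - s) * real N \<le> 0"
        using k by (auto simp: algebra_simps abs_if split: if_splits)
      then show ?thesis using s by (auto simp: U_def zero_le_mult_iff mult_le_0_iff)
    qed
    then have "I N {k. \<bar>real k - v * real N\<bar> > \<epsilon> * real N} \<le>
        (\<integral>\<^sup>+k. ennreal ((real k + 1) * neg_binom q N k) * indicator (U s N) k
          + ennreal ((real k + 1) * neg_binom q N k) * indicator (U (- s) N) k \<partial>count_space UNIV)"
      unfolding I_def by (intro nn_integral_mono) (auto simp: indicator_def)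
    also have "\<dots> = I N (U s N) + I N (U (- s) N)"
      unfolding I_def by (rule nn_integral_add) auto
    also have "\<dots> \<le> ennreal (C1 * real N * r1 ^ N) + ennreal (C2 * real N * r2 ^ N)"
      using I[OF N] by (rule add_mono)
    also have "\<dots> = ennreal (C1 * real N * r1 ^ N + C2 * real N * r2 ^ N)"
      using C r by simp
    also have "\<dots> \<le> ennreal (C1 * real N * max r1 r2 ^ N + C2 * real N * max r1 r2 ^ N)"
      using C r by (intro ennreal_leI add_mono mult_left_mono power_mono) auto
    finally show ?thesis by (simp add: algebra_simps)
  qed
  then show ?thesis unfolding I_def v_def[symmetric]
    using C r by (intro exI[of _ "C1 + C2"] exI[of _ "max r1 r2"]) auto
qed

text \<open>With \<open>s\<close> the \<open>m\<close>-th root of \<open>r\<close>, the sequence is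
  the \<open>m\<close>-th power of \<open>N * s ^ N\<close>.\<close>

lemma poly_times_power_tendsto_0:
  fixes r :: real
  assumes "0 \<le> r" "r < 1" "m > 0"
  shows "(\<lambda>N. real N ^ m * r ^ N) \<longlonglongrightarrow> 0"
proof -
  define s where "s = root m r"
  have s: "s ^ m = r" "0 \<le> s" "s < 1"
    using assms by (auto simp: s_def real_root_ge_zero)
  have "(\<lambda>N. (real N * s ^ N) ^ m) \<longlonglongrightarrow> 0 ^ m"
    by (intro tendsto_power powser_times_n_limit_0) (use s in simp)
  moreover have "(real N * s ^ N) ^ m = real N ^ m * r ^ N" for N
    by (metis mult.commute power_mult power_mult_distrib s(1))
  ultimately show ?thesis using assms by (simp add: zero_power)
qed

text \<open>A pigeonhole argument in place of Stirling's formula: the mass near the mean tends to 1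
  and is spread over a number of atoms linear in \<open>N\<close>, so one of them carries at least a
  constant over \<open>N\<close>.\<close>

lemma neg_binom_typical:
  assumes "0 < q" "q < 1" "\<epsilon> > 0"
  shows "\<exists>\<kappa>>0. \<forall>\<^sub>F N in sequentially. \<exists>k. \<bar>real k - q / (1 - q) * real N\<bar> \<le> \<epsilon> * real N
    \<and> neg_binom q N k \<ge> \<kappa> / real N"
proof -
  define v where "v = q / (1 - q)"
  have v: "v > 0" using assms by (simp add: v_def)
  \<comment> \<open>With at most \<open>(v + \<epsilon> + 1) * N\<close> atoms of mass at most
    \<open>\<kappa> / N\<close>, the typical window would carry at most 1/4; the tails carry at most
    1/2, which contradicts total mass 1.\<close>
  define \<kappa> where "\<kappa> = 1 / (4 * (v + \<epsilon> + 1))"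
  have k0: "\<kappa> > 0" using v assms by (simp add: \<kappa>_def)
  obtain C r where r: "0 < r" "r < 1" "C \<ge> 0"
    and I: "\<And>N. N \<ge> 1 \<Longrightarrow> (\<integral>\<^sup>+k. ennreal ((real k + 1) * neg_binom q N k)
        * indicator {k. \<bar>real k - v * real N\<bar> > \<epsilon> * real N} k \<partial>count_space UNIV)
      \<le> ennreal (C * real N * r ^ N)"
    using neg_binom_concentration[OF assms] unfolding v_def by blast
  have "(\<lambda>N. C * (real N ^ 1 * r ^ N)) \<longlonglongrightarrow> C * 0"
    using r by (intro tendsto_mult_left poly_times_power_tendsto_0) auto
  then have "\<forall>\<^sub>F N in sequentially. C * (real N ^ 1 * r ^ N) < 1 / 2"
    by (rule order_tendstoD) auto
  then have "\<forall>\<^sub>F N in sequentially. \<exists>k. \<bar>real k - v * real N\<bar> \<le> \<epsilon> * real N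
    \<and> neg_binom q N k \<ge> \<kappa> / real N"
    using eventually_ge_at_top[of 1]
  proof eventually_elim
    case (elim N)
    let ?B = "{k. \<bar>real k - v * real N\<bar> > \<epsilon> * real N}"
    show ?case
    proof (rule ccontr)
      assume "\<not> ?case"
      then have small: "neg_binom q N k \<le> \<kappa> / real N" if "k \<notin> ?B" for k
        using that by (auto simp: not_le dest!: spec[of _ k])
      define n where "n = nat \<lfloor>(v + \<epsilon>) * real N\<rfloor>"
      have n: "real n \<le> (v + \<epsilon>) * real N" using v assms by (simp add: n_def)
      have sub: "- ?B \<subseteq> {..n}"
      proof
        fix k assume "k \<in> - ?B"
        then have "real k \<le> (v + \<epsilon>) * real N" by (auto simp: abs_le_iff algebra_simps)
        then show "k \<in> {..n}" using v assms by (simp add: n_def le_nat_floor)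
      qed
      have nb: "ennreal (neg_binom q N k) \<le> ennreal ((real k + 1) * neg_binom q N k) * indicator ?B k
          + ennreal (\<kappa> / real N) * indicator {..n} k" for k
      proof (cases "k \<in> ?B")
        case True
        have "1 * neg_binom q N k \<le> (real k + 1) * neg_binom q N k"
          using assms by (intro mult_right_mono neg_binom_nonneg) auto
        then show ?thesis using True by (simp add: add_increasing2 ennreal_leI)
      next
        case False
        then have "k \<in> {..n}" using sub by blast
        then show ?thesis using small[OF False] False by (auto simp: ennreal_leI)
      qed
      have "1 = (\<integral>\<^sup>+k. ennreal (neg_binom q N k) \<partial>count_space UNIV)"
        using nn_integral_neg_binom[OF assms(1,2)] by simp
      also have "\<dots> \<le> (\<integral>\<^sup>+k. ennreal ((real k + 1) * neg_binom q N k) * indicator ?B k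
          + ennreal (\<kappa> / real N) * indicator {..n} k \<partial>count_space UNIV)"
        using nb by (intro nn_integral_mono) auto
      also have "\<dots> = (\<integral>\<^sup>+k. ennreal ((real k + 1) * neg_binom q N k) * indicator ?B k \<partial>count_space UNIV)
          + ennreal (\<kappa> / real N) * of_nat (Suc n)"
        by (subst nn_integral_add) (auto simp: nn_integral_cmult_indicator)
      also have "\<dots> \<le> ennreal (C * real N * r ^ N) + ennreal (\<kappa> / real N * real (Suc n))"
      proof (rule add_mono)
        have "ennreal (\<kappa> / real N) * of_nat (Suc n) = ennreal (\<kappa> / real N * real (Suc n))"
          unfolding ennreal_of_nat_eq_real_of_nat using k0 by (intro ennreal_mult[symmetric]) auto
        then show "ennreal (\<kappa> / real N) * of_nat (Suc n) \<le> ennreal (\<kappa> / real N * real (Suc n))"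
          by simp
      qed (use I[of N] elim in auto)
      also have "\<dots> = ennreal (C * real N * r ^ N + \<kappa> / real N * real (Suc n))"
        using r k0 by (intro ennreal_plus[symmetric]) auto
      also have "\<dots> \<le> ennreal (1 / 2 + 1 / 4)"
      proof (intro ennreal_leI add_mono)
        show "C * real N * r ^ N \<le> 1 / 2" using elim by (simp add: mult.assoc)
        have "real (Suc n) \<le> (v + \<epsilon> + 1) * real N" using n elim by (simp add: algebra_simps)
        then have "\<kappa> / real N * real (Suc n) \<le> \<kappa> / real N * ((v + \<epsilon> + 1) * real N)"
          using k0 by (intro mult_left_mono) auto
        also have "\<dots> = 1 / 4"
          using elim v assms by (simp add: \<kappa>_def nonzero_divide_eq_eq del: distrib_left_numeral)
        finally show "\<kappa> / real N * real (Suc n) \<le> 1 / 4" .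
      qed
      finally have "ennreal 1 \<le> ennreal (3 / 4)" by simp
      then show False by (subst (asm) ennreal_le_iff) auto
    qed
  qed
  then show ?thesis unfolding v_def using k0 by blast
qed

lemma nn_integral_triple:
  fixes F :: "nat \<times> nat \<times> nat \<Rightarrow> ennreal"
  shows "(\<integral>\<^sup>+t. F t \<partial>count_space UNIV)
    = (\<integral>\<^sup>+p. \<integral>\<^sup>+q. \<integral>\<^sup>+l. F (p, q, l) \<partial>count_space UNIV \<partial>count_space UNIV \<partial>count_space UNIV)"
  by (simp add: nn_integral_fst_count_space[of "\<lambda>x. F (_, x)"] nn_integral_fst_count_space[of F, symmetric])

section \<open>Tilting and concentration of the shape\<close>

text \<open>In \<open>schur_dim_product\<close> the factor \<open>(p - q + 1) * (N - 1)\<close> is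
  at least \<open>N / 2\<close>, while \<open>p + 1\<close> and \<open>N + q - 1\<close> are both at
  most \<open>(K + 1) * N\<close>. Cancellation in the determinant thus costs only a factor linear
  in \<open>N\<close>.\<close>

lemma schur_dim_ge:
  assumes "q \<le> p" "N \<ge> 2" "real p \<le> K * real N" "real q \<le> K * real N"
  shows "real (multichoose N p) * real (multichoose N q) \<le> 2 * (K + 1)\<^sup>2 * real N * real_of_int (schur_dim N p q)"
proof -
  let ?H = "real (multichoose N p) * real (multichoose N q)"
  have N: "real N \<ge> 2" using assms by simp
  have eq: "(real p + 1) * (real N + real q - 1) * real_of_int (schur_dim N p q)
      = ?H * (real p - real q + 1) * (real N - 1)"
    using arg_cong[OF schur_dim_product[OF assms(1), of N], of real_of_int] by simp
  have K: "K \<ge> 0"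
  proof (rule ccontr)
    assume "\<not> K \<ge> 0"
    then have "K * real N < 0" using N by (simp add: mult_less_0_iff)
    then show False using assms(3) by linarith
  qed
  have S: "real_of_int (schur_dim N p q) \<ge> 0"
  proof (rule ccontr)
    assume "\<not> ?thesis"
    moreover have "(real p + 1) * (real N + real q - 1) > 0" using N by simp
    ultimately have "(real p + 1) * (real N + real q - 1) * real_of_int (schur_dim N p q) < 0"
      by (simp add: mult_less_0_iff)
    moreover have "?H * (real p - real q + 1) * (real N - 1) \<ge> 0" using N assms by simp
    ultimately show False using eq by linarith
  qed
  have "?H * real N \<le> ?H * (2 * ((real p - real q + 1) * (real N - 1)))"
  proof (rule mult_left_mono)
    have "real N \<le> 2 * (1 * (real N - 1))" using N by simp
    also have "\<dots> \<le> 2 * ((real p - real q + 1) * (real N - 1))"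
      using N assms by (intro mult_left_mono mult_right_mono) auto
    finally show "real N \<le> 2 * ((real p - real q + 1) * (real N - 1))" .
  qed auto
  also have "\<dots> = 2 * ((real p + 1) * (real N + real q - 1) * real_of_int (schur_dim N p q))"
    unfolding eq by simp
  also have "\<dots> \<le> 2 * (((K + 1) * real N) * ((K + 1) * real N) * real_of_int (schur_dim N p q))"
    using N assms K S by (intro mult_left_mono mult_right_mono mult_mono) (auto simp: algebra_simps)
  finally have "?H * real N \<le> (2 * (K + 1)\<^sup>2 * real N * real_of_int (schur_dim N p q)) * real N"
    by (simp add: power2_eq_square mult_ac del: distrib_left_numeral distrib_right_numeral)
  then show ?thesis using N by (subst (asm) mult_le_cancel_right) auto
qed

context geo
begin

text \<open>\<open>v1\<close> and \<open>v2\<close> are the limits of \<open>p / N\<close> and \<open>q / N\<close>.\<close>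

definition c :: real where "c = max 1 (max c1 c2)"
definition q1 :: real where "q1 = a * c"
definition q2 :: real where "q2 = a / c"
definition v1 :: real where "v1 = q1 / (1 - q1)"
definition v2 :: real where "v2 = q2 / (1 - q2)"
text \<open>What is left of the boundary weights once powers of \<open>c\<close> have been moved
  into \<open>q1\<close> and \<open>q2\<close>. Both bases are at most 1, and for
  \<open>c > 1\<close> at least one of them equals 1.\<close>

definition \<theta> :: "nat \<Rightarrow> nat \<Rightarrow> nat \<Rightarrow> real" where
  "\<theta> p q l = (c1 / c) ^ (p - l) * (c2 / c) ^ (l - q)"

lemma c: "1 \<le> c" "c1 \<le> c" "c2 \<le> c"
  by (auto simp: c_def)

lemma q1: "0 < q1" "q1 < 1"
  using a c1 c2 c(1) by (auto simp: q1_def c_def max_def)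

lemma q2_le_q1: "q2 \<le> q1"
proof -
  have "a / c \<le> a / 1" using a c by (intro divide_left_mono) auto
  also have "\<dots> \<le> a * c" using mult_left_mono[OF c(1), of a] a by simp
  finally show ?thesis by (simp add: q1_def q2_def)
qed

lemma q2: "0 < q2" "q2 < 1"
  using a c(1) q2_le_q1 q1 by (auto simp: q2_def)

lemma v2_less_v1: "c > 1 \<Longrightarrow> v2 < v1"
proof -
  assume "c > 1"
  then have "a * 1 < a * c" using a by (intro mult_strict_left_mono) auto
  moreover have "a / c < a" using \<open>c > 1\<close> a by (simp add: field_simps)
  ultimately have "q2 < q1" by (simp add: q1_def q2_def)
  then show ?thesis unfolding v1_def v2_def using q1 q2 by (intro frac_less) auto
qed

lemma v_pos: "0 < v1" "0 < v2"
  using q1 q2 by (auto simp: v1_def v2_def)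

lemma theta_bounds: "0 \<le> \<theta> p q l" "\<theta> p q l \<le> 1"
proof -
  show "0 \<le> \<theta> p q l" using c1 c2 c by (auto simp: \<theta>_def)
  have "(c1 / c) ^ (p - l) \<le> 1" "(c2 / c) ^ (l - q) \<le> 1"
    using c1 c2 c by (auto intro!: power_le_one)
  then show "\<theta> p q l \<le> 1" unfolding \<theta>_def using c2 c by (intro mult_le_one) auto
qed

section \<open>Comparison with independent negative binomials\<close>

lemma shape_mass_eq:
  assumes "q \<le> l" "l \<le> p"
  shows "shape_mass a c1 c2 N (p, q, l) = q1 ^ p * q2 ^ q * \<theta> p q l * real_of_int (schur_dim N p q)"
proof -
  \<comment> \<open>Since \<open>p - q\<close> is \<open>(p - l) + (l - q)\<close>, the powers of
    \<open>c\<close> introduced by \<open>q1\<close> and \<open>q2\<close> cancel those in the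
    denominators of \<open>\<theta>\<close>.\<close>
  have "c ^ p = c ^ (p - l) * c ^ (l - q) * c ^ q"
    using assms by (simp flip: power_add)
  then have "q1 ^ p * q2 ^ q * \<theta> p q l = a ^ (p + q) * c1 ^ (p - l) * c2 ^ (l - q)"
    using c by (simp add: q1_def q2_def \<theta>_def power_mult_distrib power_divide power_add)
  then show ?thesis using assms by (simp add: shape_mass_def)
qed

lemma shape_mass_le:
  assumes "N \<ge> 1" "q \<le> l" "l \<le> p"
  shows "shape_mass a c1 c2 N (p, q, l) * ((1 - q1) ^ N * (1 - q2) ^ N)
    \<le> neg_binom q1 N p * neg_binom q2 N q * \<theta> p q l"
proof -
  have "real_of_int (schur_dim N p q) \<le> real_of_int (int (multichoose N p) * int (multichoose N q))"
    using schur_dim_le by (simp only: of_int_le_iff)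
  then have "q1 ^ p * q2 ^ q * \<theta> p q l * real_of_int (schur_dim N p q) * ((1 - q1) ^ N * (1 - q2) ^ N)
    \<le> q1 ^ p * q2 ^ q * \<theta> p q l * (real (multichoose N p) * real (multichoose N q)) * ((1 - q1) ^ N * (1 - q2) ^ N)"
    using q1 q2 theta_bounds by (intro mult_right_mono mult_left_mono) auto
  then show ?thesis by (simp add: shape_mass_eq assms neg_binom_def mult_ac)
qed

text \<open>Supplies one heavy shape to bound the normaliser from below. For \<open>c = 1\<close>
  the two means coincide and \<open>p = q = l\<close> is taken, so that \<open>q \<le> p\<close>
  holds; for \<open>c > 1\<close> the means are separated and \<open>l\<close> sits at an end of
  \<open>{q..p}\<close>.\<close>

lemma typical_shape:
  "\<exists>\<kappa>>0. \<exists>K\<ge>0. \<forall>\<^sub>F N in sequentially. \<exists>p q l. q \<le> l \<and> l \<le> p \<and> \<theta> p q l = 1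
    \<and> real p \<le> K * real N \<and> real q \<le> K * real N
    \<and> neg_binom q1 N p \<ge> \<kappa> / real N \<and> neg_binom q2 N q \<ge> \<kappa> / real N"
proof (cases "c = 1")
  case True
  then have q: "q2 = q1" by (simp add: q1_def q2_def)
  obtain \<kappa> where k: "\<kappa> > 0" and ev: "\<forall>\<^sub>F N in sequentially. \<exists>k. \<bar>real k - v1 * real N\<bar> \<le> 1 * real N
    \<and> neg_binom q1 N k \<ge> \<kappa> / real N"
    using neg_binom_typical[OF q1, of 1] unfolding v1_def by auto
  have "\<forall>\<^sub>F N in sequentially. \<exists>p q l. q \<le> l \<and> l \<le> p \<and> \<theta> p q l = 1
    \<and> real p \<le> (v1 + 1) * real N \<and> real q \<le> (v1 + 1) * real N
    \<and> neg_binom q1 N p \<ge> \<kappa> / real N \<and> neg_binom q2 N q \<ge> \<kappa> / real N"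
    using ev
  proof eventually_elim
    case (elim N)
    then obtain k where "\<bar>real k - v1 * real N\<bar> \<le> 1 * real N" "neg_binom q1 N k \<ge> \<kappa> / real N" by blast
    then show ?case
      unfolding q by (intro exI[of _ k]) (auto simp: \<theta>_def algebra_simps)
  qed
  then show ?thesis using k v_pos by (intro exI[of _ \<kappa>] conjI exI[of _ "v1 + 1"]) auto
next
  case False
  then have c1': "c > 1" using c by simp
  \<comment> \<open>Half the distance of the means: the two windows then meet at most in an end
    point, which forces \<open>q \<le> p\<close>.\<close>
  define \<epsilon> where "\<epsilon> = (v1 - v2) / 2"
  have e: "\<epsilon> > 0" "v2 + \<epsilon> = v1 - \<epsilon>" using v2_less_v1[OF c1'] by (auto simp: \<epsilon>_def field_simps)
  obtain \<kappa>1 where k1: "\<kappa>1 > 0" and ev1: "\<forall>\<^sub>F N in sequentially. \<exists>k. \<bar>real k - v1 * real N\<bar> \<le> \<epsilon> * real N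
    \<and> neg_binom q1 N k \<ge> \<kappa>1 / real N"
    using neg_binom_typical[OF q1 e(1)] unfolding v1_def by auto
  obtain \<kappa>2 where k2: "\<kappa>2 > 0" and ev2: "\<forall>\<^sub>F N in sequentially. \<exists>k. \<bar>real k - v2 * real N\<bar> \<le> \<epsilon> * real N
    \<and> neg_binom q2 N k \<ge> \<kappa>2 / real N"
    using neg_binom_typical[OF q2 e(1)] unfolding v2_def by auto
  define \<kappa> where "\<kappa> = min \<kappa>1 \<kappa>2"
  have "\<forall>\<^sub>F N in sequentially. \<exists>p q l. q \<le> l \<and> l \<le> p \<and> \<theta> p q l = 1
    \<and> real p \<le> (v1 + \<epsilon>) * real N \<and> real q \<le> (v1 + \<epsilon>) * real N
    \<and> neg_binom q1 N p \<ge> \<kappa> / real N \<and> neg_binom q2 N q \<ge> \<kappa> / real N"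
    using ev1 ev2
  proof eventually_elim
    case (elim N)
    then obtain p q where p: "\<bar>real p - v1 * real N\<bar> \<le> \<epsilon> * real N" "neg_binom q1 N p \<ge> \<kappa>1 / real N"
      and q: "\<bar>real q - v2 * real N\<bar> \<le> \<epsilon> * real N" "neg_binom q2 N q \<ge> \<kappa>2 / real N" by blast
    have "real q \<le> (v2 + \<epsilon>) * real N" using q by (auto simp: algebra_simps abs_le_iff)
    also have "\<dots> \<le> real p" unfolding e(2) using p by (auto simp: algebra_simps abs_le_iff)
    finally have qp: "real q \<le> real p" .
    have pK: "real p \<le> (v1 + \<epsilon>) * real N" using p by (auto simp: algebra_simps abs_le_iff)
    have kk: "\<kappa> / real N \<le> \<kappa>1 / real N" "\<kappa> / real N \<le> \<kappa>2 / real N"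
      by (auto simp: \<kappa>_def intro!: divide_right_mono)
    from False have "c = c1 \<or> c = c2" by (auto simp: c_def max_def split: if_splits)
    \<comment> \<open>\<open>l = q\<close> leaves only powers of \<open>c1 / c\<close>,
      \<open>l = p\<close> only powers of \<open>c2 / c\<close>.\<close>
    then have "\<theta> p q q = 1 \<or> \<theta> p q p = 1" using c1 c2 by (auto simp: \<theta>_def)
    then show ?case
      using qp pK p q kk by (meson of_nat_le_iff order.refl order.trans)
  qed
  then show ?thesis using k1 k2 v_pos e
    by (intro exI[of _ \<kappa>] conjI exI[of _ "v1 + \<epsilon>"]) (auto simp: \<kappa>_def)
qed

text \<open>One typical shape suffices. Two of the three factors \<open>N\<close> come from the two
  atoms in \<open>typical_shape\<close>, the third from \<open>schur_dim_ge\<close>.\<close>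

lemma Z_lower:
  "\<exists>\<kappa>>0. \<forall>\<^sub>F N in sequentially. Z_Geo a c1 c2 N * ((1 - q1) ^ N * (1 - q2) ^ N) \<ge> \<kappa> / real N ^ 3"
proof -
  obtain \<kappa> K where k: "\<kappa> > 0" and K: "K \<ge> 0"
    and ev: "\<forall>\<^sub>F N in sequentially. \<exists>p q l. q \<le> l \<and> l \<le> p \<and> \<theta> p q l = 1
    \<and> real p \<le> K * real N \<and> real q \<le> K * real N
    \<and> neg_binom q1 N p \<ge> \<kappa> / real N \<and> neg_binom q2 N q \<ge> \<kappa> / real N"
    using typical_shape by blast
  define D where "D = 2 * (K + 1)\<^sup>2"
  have D: "D > 0" using K by (simp add: D_def)
  have "\<forall>\<^sub>F N in sequentially. Z_Geo a c1 c2 N * ((1 - q1) ^ N * (1 - q2) ^ N) \<ge> (\<kappa>\<^sup>2 / D) / real N ^ 3"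
    using ev eventually_ge_at_top[of 2]
  proof eventually_elim
    case (elim N)
    then obtain p q l where ql: "q \<le> l" "l \<le> p" "\<theta> p q l = 1"
      and KN: "real p \<le> K * real N" "real q \<le> K * real N"
      and nb: "neg_binom q1 N p \<ge> \<kappa> / real N" "neg_binom q2 N q \<ge> \<kappa> / real N" by blast
    let ?E = "(1 - q1) ^ N * (1 - q2) ^ N"
    have E: "?E \<ge> 0" using q1 q2 by simp
    have N: "real N \<ge> 2" using elim by simp
    have "\<kappa> / real N * (\<kappa> / real N) \<le> neg_binom q1 N p * neg_binom q2 N q"
      using nb k q1 by (intro mult_mono neg_binom_nonneg) auto
    also have "\<dots> = (real (multichoose N p) * real (multichoose N q)) * (q1 ^ p * q2 ^ q * ?E)"
      by (simp add: neg_binom_def mult_ac)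
    also have "\<dots> \<le> (D * real N * real_of_int (schur_dim N p q)) * (q1 ^ p * q2 ^ q * ?E)"
      unfolding D_def using ql elim KN E q1 q2
      by (intro mult_right_mono schur_dim_ge mult_nonneg_nonneg) auto
    also have "\<dots> = D * real N * (shape_mass a c1 c2 N (p, q, l) * ?E)"
      using ql by (simp add: shape_mass_eq mult_ac)
    also have "\<dots> \<le> D * real N * (Z_Geo a c1 c2 N * ?E)"
      using D E elim by (intro mult_left_mono mult_right_mono shape_mass_le_Z) auto
    finally have *: "\<kappa> / real N * (\<kappa> / real N) \<le> D * real N * (Z_Geo a c1 c2 N * ?E)" .
    then have "\<kappa>\<^sup>2 / real N ^ 2 / (D * real N) \<le> Z_Geo a c1 c2 N * ?E"
      using D N by (subst pos_divide_le_eq) (auto simp: power2_eq_square mult_ac)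
    then show ?case using N by (simp add: power2_eq_square power3_eq_cube mult_ac)
  qed
  moreover have "\<kappa>\<^sup>2 / D > 0" using k D by simp
  ultimately show ?thesis by blast
qed

text \<open>Dividing \<open>shape_mass_le\<close> by \<open>Z_lower\<close> cancels the constants
  \<open>(1 - q1) ^ N\<close> and \<open>(1 - q2) ^ N\<close>.\<close>

lemma shape_prob_le:
  "\<exists>D>0. \<forall>\<^sub>F N in sequentially. \<forall>p q l. q \<le> l \<longrightarrow> l \<le> p \<longrightarrow>
    shape_mass a c1 c2 N (p, q, l) / Z_Geo a c1 c2 N
      \<le> D * real N ^ 3 * neg_binom q1 N p * neg_binom q2 N q * \<theta> p q l"
proof -
  obtain \<kappa> where k: "\<kappa> > 0"
    and ev: "\<forall>\<^sub>F N in sequentially. Z_Geo a c1 c2 N * ((1 - q1) ^ N * (1 - q2) ^ N) \<ge> \<kappa> / real N ^ 3"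
    using Z_lower by blast
  have "\<forall>\<^sub>F N in sequentially. \<forall>p q l. q \<le> l \<longrightarrow> l \<le> p \<longrightarrow>
    shape_mass a c1 c2 N (p, q, l) / Z_Geo a c1 c2 N
      \<le> (1 / \<kappa>) * real N ^ 3 * neg_binom q1 N p * neg_binom q2 N q * \<theta> p q l"
    using ev eventually_ge_at_top[of 1]
  proof eventually_elim
    case (elim N)
    show ?case
    proof (intro allI impI)
      fix p q l :: nat assume ql: "q \<le> l" "l \<le> p"
      let ?E = "(1 - q1) ^ N * (1 - q2) ^ N"
      let ?m = "shape_mass a c1 c2 N (p, q, l)"
      have E: "?E > 0" using q1 q2 by simp
      have Z: "Z_Geo a c1 c2 N > 0" using Z_pos elim by simp
      have N: "real N ^ 3 > 0" using elim by simp
      have "\<kappa> \<le> real N ^ 3 * (Z_Geo a c1 c2 N * ?E)"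
        using elim N by (simp add: pos_divide_le_eq mult_ac)
      moreover have "?m / Z_Geo a c1 c2 N \<ge> 0"
        using shape_mass_nonneg[of N] Z elim by simp
      ultimately have "?m / Z_Geo a c1 c2 N * \<kappa>
          \<le> ?m / Z_Geo a c1 c2 N * (real N ^ 3 * (Z_Geo a c1 c2 N * ?E))"
        by (rule mult_left_mono)
      also have "\<dots> = real N ^ 3 * (?m * ?E)" using Z by simp
      also have "\<dots> \<le> real N ^ 3 * (neg_binom q1 N p * neg_binom q2 N q * \<theta> p q l)"
        using N elim ql by (intro mult_left_mono shape_mass_le) auto
      finally show "?m / Z_Geo a c1 c2 N
          \<le> (1 / \<kappa>) * real N ^ 3 * neg_binom q1 N p * neg_binom q2 N q * \<theta> p q l"
        using k by (simp add: pos_le_divide_eq mult_ac)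
    qed
  qed
  then show ?thesis using k by (intro exI[of _ "1 / \<kappa>"]) auto
qed

end

lemma card_nat_interval_le:
  fixes A B :: real
  assumes "finite S" "A \<le> B" "\<And>l. l \<in> S \<Longrightarrow> A \<le> real l \<and> real l \<le> B"
  shows "real (card S) \<le> B - A + 1"
proof (cases "S = {}")
  case False
  have "S \<subseteq> {Min S..Max S}" using assms(1) by auto
  then have "card S \<le> card {Min S..Max S}" by (intro card_mono) auto
  also have "\<dots> = Suc (Max S) - Min S" by simp
  finally have "card S \<le> Suc (Max S) - Min S" .
  moreover have "Min S \<le> Max S" using assms(1) False by simp
  ultimately have "real (card S) \<le> real (Max S) - real (Min S) + 1" by linarith
  then show ?thesis
    using assms(3)[of "Min S"] assms(3)[of "Max S"] Min_in[OF assms(1) False] Max_in[OF assms(1) False]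
    by linarith
qed (use assms in auto)

lemma ennreal_mult_triple:
  "0 \<le> x \<Longrightarrow> 0 \<le> y \<Longrightarrow> 0 \<le> z \<Longrightarrow> ennreal x * ennreal y * ennreal z = ennreal (x * y * z)"
  by (simp add: ennreal_mult)

lemma measure_tendsto_0:
  assumes "\<forall>\<^sub>F N in sequentially. emeasure (M N) (X N) \<le> ennreal (b N)" "\<And>N. 0 \<le> b N" "b \<longlonglongrightarrow> 0"
  shows "(\<lambda>N. measure (M N) (X N)) \<longlonglongrightarrow> 0"
proof (rule real_tendsto_sandwich[OF _ _ tendsto_const assms(3)])
  show "\<forall>\<^sub>F N in sequentially. measure (M N) (X N) \<le> b N"
    using assms(1)
  proof eventually_elim
    case (elim N)
    then show ?case using assms(2)[of N] by (auto simp: measure_def intro!: enn2real_leI)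
  qed
qed auto

section \<open>Exponential bounds for events on the shape\<close>

context geo
begin

definition event :: "nat \<Rightarrow> (nat \<times> nat \<times> nat) set \<Rightarrow> ((nat \<Rightarrow> nat) \<times> (nat \<Rightarrow> nat)) set" where
  "event N B = {L \<in> paths N \<times> paths N. shape N L \<in> B}"

lemma event_in_sets [simp]: "event N B \<in> sets (P_Geo a c1 c2 N)"
  by (auto simp: event_def sets_P_Geo)

lemma measure_event_cover:
  assumes "N \<ge> 1" "X \<subseteq> event N A \<union> event N B"
  shows "measure (P_Geo a c1 c2 N) X \<le> measure (P_Geo a c1 c2 N) (event N A) + measure (P_Geo a c1 c2 N) (event N B)"
proof -
  interpret prob_space "P_Geo a c1 c2 N" by (rule prob_space_P[OF assms(1)])
  have "prob X \<le> prob (event N A \<union> event N B)"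
    using assms(2) by (intro finite_measure_mono) auto
  also have "\<dots> \<le> prob (event N A) + prob (event N B)"
    by (intro measure_Un_le) auto
  finally show ?thesis .
qed

lemma measure_cover_tendsto_0:
  assumes "\<And>N. N \<ge> 1 \<Longrightarrow> X N \<subseteq> event N (A N) \<union> event N (B N)"
    and "(\<lambda>N. measure (P_Geo a c1 c2 N) (event N (A N))) \<longlonglongrightarrow> 0"
    and "(\<lambda>N. measure (P_Geo a c1 c2 N) (event N (B N))) \<longlonglongrightarrow> 0"
  shows "(\<lambda>N. measure (P_Geo a c1 c2 N) (X N)) \<longlonglongrightarrow> 0"
proof (rule real_tendsto_sandwich[OF _ _ tendsto_const])
  show "\<forall>\<^sub>F N in sequentially. measure (P_Geo a c1 c2 N) (X N)
      \<le> measure (P_Geo a c1 c2 N) (event N (A N)) + measure (P_Geo a c1 c2 N) (event N (B N))"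
    using eventually_ge_at_top[of 1] by eventually_elim (intro measure_event_cover assms(1))
  show "(\<lambda>N. measure (P_Geo a c1 c2 N) (event N (A N)) + measure (P_Geo a c1 c2 N) (event N (B N))) \<longlonglongrightarrow> 0"
    using tendsto_add[OF assms(2,3)] by simp
qed auto

text \<open>For fixed \<open>p\<close> and \<open>q\<close> at most \<open>p + 1\<close> values of
  \<open>l\<close> carry mass, and on the event \<open>\<theta>\<close> is at most \<open>x\<close>;
  this explains the weight in the first integral, and the rest factorises. The quantifiers stand
  inside the \<open>eventually\<close> so that \<open>A\<close>, \<open>B\<close> and
  \<open>x\<close> may depend on \<open>N\<close>.\<close>

lemma box_prob_le:
  "\<exists>D>0. \<forall>\<^sub>F N in sequentially. \<forall>A B x. x \<ge> 0 \<longrightarrow>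
    emeasure (P_Geo a c1 c2 N) (event N {(p, q, l). p \<in> A \<and> q \<in> B \<and> \<theta> p q l \<le> x})
    \<le> ennreal (D * real N ^ 3 * x)
      * (\<integral>\<^sup>+p. ennreal ((real p + 1) * neg_binom q1 N p) * indicator A p \<partial>count_space UNIV)
      * (\<integral>\<^sup>+q. ennreal (neg_binom q2 N q) * indicator B q \<partial>count_space UNIV)"
proof -
  obtain D where D: "D > 0" and ev: "\<forall>\<^sub>F N in sequentially. \<forall>p q l. q \<le> l \<longrightarrow> l \<le> p \<longrightarrow>
    shape_mass a c1 c2 N (p, q, l) / Z_Geo a c1 c2 N
      \<le> D * real N ^ 3 * neg_binom q1 N p * neg_binom q2 N q * \<theta> p q l"
    using shape_prob_le by blast
  have "\<forall>\<^sub>F N in sequentially. \<forall>A B x. x \<ge> 0 \<longrightarrow>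
    emeasure (P_Geo a c1 c2 N) (event N {(p, q, l). p \<in> A \<and> q \<in> B \<and> \<theta> p q l \<le> x})
    \<le> ennreal (D * real N ^ 3 * x)
      * (\<integral>\<^sup>+p. ennreal ((real p + 1) * neg_binom q1 N p) * indicator A p \<partial>count_space UNIV)
      * (\<integral>\<^sup>+q. ennreal (neg_binom q2 N q) * indicator B q \<partial>count_space UNIV)"
    using ev eventually_ge_at_top[of 1]
  proof eventually_elim
    case (elim N)
    show ?case
    proof (intro allI impI)
      fix A B :: "nat set" and x :: real assume x: "x \<ge> 0"
      let ?S = "{(p, q, l). p \<in> A \<and> q \<in> B \<and> \<theta> p q l \<le> x}"
      let ?F = "\<lambda>t. ennreal (shape_mass a c1 c2 N t / Z_Geo a c1 c2 N) * indicator ?S t"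
      let ?f = "\<lambda>p. ennreal ((real p + 1) * neg_binom q1 N p) * indicator A p"
      let ?g = "\<lambda>q. ennreal (neg_binom q2 N q) * indicator B q"
      let ?K = "D * real N ^ 3 * x"
      have K: "?K \<ge> 0" using D x by simp
      have nb: "neg_binom q1 N p \<ge> 0" "neg_binom q2 N p \<ge> 0" for p
        using q1 q2 by (simp_all add: neg_binom_nonneg)
      have row: "(\<integral>\<^sup>+l. ?F (p, q, l) \<partial>count_space UNIV) \<le> ennreal ?K * ?f p * ?g q" for p q
      proof (cases "p \<in> A \<and> q \<in> B")
        case True
        let ?b = "?K * neg_binom q1 N p * neg_binom q2 N q"
        have b: "?b \<ge> 0" by (rule mult_nonneg_nonneg[OF mult_nonneg_nonneg[OF K nb(1)] nb(2)])
        have "?F (p, q, l) \<le> ennreal ?b * indicator {..p} l" for l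
        proof (cases "q \<le> l \<and> l \<le> p \<and> \<theta> p q l \<le> x")
          case in': True
          have "shape_mass a c1 c2 N (p, q, l) / Z_Geo a c1 c2 N
              \<le> D * real N ^ 3 * neg_binom q1 N p * neg_binom q2 N q * \<theta> p q l"
            using elim(1) in' by blast
          also have "\<dots> \<le> D * real N ^ 3 * neg_binom q1 N p * neg_binom q2 N q * x"
            using in' D nb by (intro mult_left_mono mult_nonneg_nonneg) auto
          finally show ?thesis using True in' by (simp add: ennreal_leI mult_ac)
        next
          case False
          then have "?F (p, q, l) = 0" by (auto simp: shape_mass_def indicator_def)
          then show ?thesis by (rule order.trans[OF eq_refl zero_le])
        qed
        then have "(\<integral>\<^sup>+l. ?F (p, q, l) \<partial>count_space UNIV)
            \<le> (\<integral>\<^sup>+l. ennreal ?b * indicator {..p} l \<partial>count_space UNIV)"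
          by (intro nn_integral_mono)
        also have "\<dots> = ennreal ?b * ennreal (real (Suc p))"
          by (simp add: nn_integral_cmult_indicator flip: ennreal_of_nat_eq_real_of_nat)
        also have "\<dots> = ennreal (?b * real (Suc p))"
          using b by (intro ennreal_mult[symmetric]) auto
        also have "?b * real (Suc p) = ?K * ((real p + 1) * neg_binom q1 N p) * neg_binom q2 N q"
          by (simp add: algebra_simps)
        also have "ennreal \<dots> = ennreal ?K * ennreal ((real p + 1) * neg_binom q1 N p) * ennreal (neg_binom q2 N q)"
          using K nb[of p] nb[of q] by (simp only: ennreal_mult mult_nonneg_nonneg add_nonneg_nonneg of_nat_0_le_iff zero_le_one)
        finally show ?thesis using True by simp
      next
        case False
        then have "?F (p, q, l) = 0" for l by auto
        then show ?thesis by (simp only: nn_integral_const mult_zero_left zero_le)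
      qed
      have "emeasure (P_Geo a c1 c2 N) (event N ?S) = (\<integral>\<^sup>+t. ?F t \<partial>count_space UNIV)"
        unfolding event_def using elim by (intro emeasure_shape) auto
      also have "\<dots> = (\<integral>\<^sup>+p. \<integral>\<^sup>+q. \<integral>\<^sup>+l. ?F (p, q, l) \<partial>count_space UNIV \<partial>count_space UNIV \<partial>count_space UNIV)"
        by (rule nn_integral_triple)
      also have "\<dots> \<le> (\<integral>\<^sup>+p. \<integral>\<^sup>+q. ennreal ?K * ?f p * ?g q \<partial>count_space UNIV \<partial>count_space UNIV)"
        by (intro nn_integral_mono row)
      also have "\<dots> = ennreal ?K * (\<integral>\<^sup>+p. ?f p \<partial>count_space UNIV) * (\<integral>\<^sup>+q. ?g q \<partial>count_space UNIV)"
        by (simp only: nn_integral_cmult nn_integral_multc borel_measurable_count_space)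
      finally show "emeasure (P_Geo a c1 c2 N) (event N ?S)
          \<le> ennreal ?K * (\<integral>\<^sup>+p. ?f p \<partial>count_space UNIV) * (\<integral>\<^sup>+q. ?g q \<partial>count_space UNIV)" .
    qed
  qed
  then show ?thesis using D by blast
qed

text \<open>The factor \<open>s ^ N\<close> beats the polynomial loss: \<open>N ^ 3\<close> from
  \<open>box_prob_le\<close> and one more \<open>N\<close> from the mean of
  \<open>p + 1\<close>.\<close>

lemma theta_not_small:
  assumes "0 < s" "s < 1"
  shows "(\<lambda>N. measure (P_Geo a c1 c2 N) (event N {(p, q, l). \<theta> p q l \<le> s ^ N})) \<longlonglongrightarrow> 0"
proof -
  obtain D where D: "D > 0" and ev: "\<forall>\<^sub>F N in sequentially. \<forall>A B x. x \<ge> 0 \<longrightarrow>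
    emeasure (P_Geo a c1 c2 N) (event N {(p, q, l). p \<in> A \<and> q \<in> B \<and> \<theta> p q l \<le> x})
    \<le> ennreal (D * real N ^ 3 * x)
      * (\<integral>\<^sup>+p. ennreal ((real p + 1) * neg_binom q1 N p) * indicator A p \<partial>count_space UNIV)
      * (\<integral>\<^sup>+q. ennreal (neg_binom q2 N q) * indicator B q \<partial>count_space UNIV)"
    using box_prob_le by blast
  show ?thesis
  proof (rule measure_tendsto_0[where b = "\<lambda>N. D / (1 - q1) * (real N ^ 4 * s ^ N)"])
    show "\<forall>\<^sub>F N in sequentially. emeasure (P_Geo a c1 c2 N) (event N {(p, q, l). \<theta> p q l \<le> s ^ N})
        \<le> ennreal (D / (1 - q1) * (real N ^ 4 * s ^ N))"
      using ev eventually_ge_at_top[of 1]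
    proof eventually_elim
      case (elim N)
      have "emeasure (P_Geo a c1 c2 N) (event N {(p, q, l). p \<in> UNIV \<and> q \<in> UNIV \<and> \<theta> p q l \<le> s ^ N})
        \<le> ennreal (D * real N ^ 3 * s ^ N)
          * (\<integral>\<^sup>+p. ennreal ((real p + 1) * neg_binom q1 N p) * indicator UNIV p \<partial>count_space UNIV)
          * (\<integral>\<^sup>+q. ennreal (neg_binom q2 N q) * indicator UNIV q \<partial>count_space UNIV)"
        using assms by (intro elim(1)[rule_format]) auto
      also have "\<dots> \<le> ennreal (D * real N ^ 3 * s ^ N) * ennreal (real N / (1 - q1)) * 1"
        using nn_integral_Suc_times_neg_binom_le[OF q1 elim(2)] nn_integral_neg_binom[OF q2, of N]
        by (intro mult_mono) auto
      also have "\<dots> = ennreal (D * real N ^ 3 * s ^ N * (real N / (1 - q1)))"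
        using D assms q1 by (simp only: mult_1_right) (intro ennreal_mult[symmetric]; auto)
      also have "D * real N ^ 3 * s ^ N * (real N / (1 - q1)) = D / (1 - q1) * (real N ^ 4 * s ^ N)"
        by (simp add: eval_nat_numeral)
      finally show ?case by simp
    qed
    have "(\<lambda>N. D / (1 - q1) * (real N ^ 4 * s ^ N)) \<longlonglongrightarrow> D / (1 - q1) * 0"
      using assms by (intro tendsto_mult_left poly_times_power_tendsto_0) auto
    then show "(\<lambda>N. D / (1 - q1) * (real N ^ 4 * s ^ N)) \<longlonglongrightarrow> 0" by simp
  qed (use D assms q1 in auto)
qed

text \<open>\<open>box_prob_le\<close> with \<open>x = 1\<close>, which is no restriction by
  \<open>theta_bounds\<close>. Each tail bound adds one \<open>N\<close> to \<open>N ^ 3\<close>,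
  and for \<open>q\<close> the unrestricted integral over \<open>p\<close> adds another.\<close>

lemma shape_concentration:
  assumes "\<epsilon> > 0"
  shows "(\<lambda>N. measure (P_Geo a c1 c2 N)
      (event N {(p, q, l). \<bar>real p - v1 * real N\<bar> > \<epsilon> * real N})) \<longlonglongrightarrow> 0" (is ?P)
    and "(\<lambda>N. measure (P_Geo a c1 c2 N)
      (event N {(p, q, l). \<bar>real q - v2 * real N\<bar> > \<epsilon> * real N})) \<longlonglongrightarrow> 0" (is ?Q)
proof -
  obtain D where D: "D > 0" and ev: "\<forall>\<^sub>F N in sequentially. \<forall>A B x. x \<ge> 0 \<longrightarrow>
    emeasure (P_Geo a c1 c2 N) (event N {(p, q, l). p \<in> A \<and> q \<in> B \<and> \<theta> p q l \<le> x})
    \<le> ennreal (D * real N ^ 3 * x)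
      * (\<integral>\<^sup>+p. ennreal ((real p + 1) * neg_binom q1 N p) * indicator A p \<partial>count_space UNIV)
      * (\<integral>\<^sup>+q. ennreal (neg_binom q2 N q) * indicator B q \<partial>count_space UNIV)"
    using box_prob_le by blast
  let ?A = "\<lambda>N. {p. \<bar>real p - v1 * real N\<bar> > \<epsilon> * real N}"
  let ?B = "\<lambda>N. {q. \<bar>real q - v2 * real N\<bar> > \<epsilon> * real N}"
  obtain C1 r1 where 1: "0 < r1" "r1 < 1" "C1 \<ge> 0"
    and I1: "\<And>N. N \<ge> 1 \<Longrightarrow> (\<integral>\<^sup>+k. ennreal ((real k + 1) * neg_binom q1 N k) * indicator (?A N) k \<partial>count_space UNIV)
      \<le> ennreal (C1 * real N * r1 ^ N)"
    using neg_binom_concentration[OF q1 assms] unfolding v1_def by blast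
  obtain C2 r2 where 2: "0 < r2" "r2 < 1" "C2 \<ge> 0"
    and I2: "\<And>N. N \<ge> 1 \<Longrightarrow> (\<integral>\<^sup>+k. ennreal ((real k + 1) * neg_binom q2 N k) * indicator (?B N) k \<partial>count_space UNIV)
      \<le> ennreal (C2 * real N * r2 ^ N)"
    using neg_binom_concentration[OF q2 assms] unfolding v2_def by blast
  show ?P
  proof (rule measure_tendsto_0[where b = "\<lambda>N. D * C1 * (real N ^ 4 * r1 ^ N)"])
    show "\<forall>\<^sub>F N in sequentially. emeasure (P_Geo a c1 c2 N) (event N {(p, q, l). \<bar>real p - v1 * real N\<bar> > \<epsilon> * real N})
        \<le> ennreal (D * C1 * (real N ^ 4 * r1 ^ N))"
      using ev eventually_ge_at_top[of 1]
    proof eventually_elim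
      case (elim N)
      have "emeasure (P_Geo a c1 c2 N) (event N {(p, q, l). p \<in> ?A N \<and> q \<in> UNIV \<and> \<theta> p q l \<le> 1})
        \<le> ennreal (D * real N ^ 3 * 1)
          * (\<integral>\<^sup>+p. ennreal ((real p + 1) * neg_binom q1 N p) * indicator (?A N) p \<partial>count_space UNIV)
          * (\<integral>\<^sup>+q. ennreal (neg_binom q2 N q) * indicator UNIV q \<partial>count_space UNIV)"
        by (intro elim(1)[rule_format]) auto
      also have "\<dots> \<le> ennreal (D * real N ^ 3) * ennreal (C1 * real N * r1 ^ N) * 1"
        using I1[OF elim(2)] nn_integral_neg_binom[OF q2, of N]
        by (intro mult_mono) auto
      also have "\<dots> = ennreal (D * real N ^ 3 * (C1 * real N * r1 ^ N))"
        using D 1 by (simp only: mult_1_right) (intro ennreal_mult[symmetric]; auto)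
      also have "D * real N ^ 3 * (C1 * real N * r1 ^ N) = D * C1 * (real N ^ 4 * r1 ^ N)"
        by (simp add: eval_nat_numeral)
      also have "{(p, q, l). p \<in> ?A N \<and> q \<in> UNIV \<and> \<theta> p q l \<le> 1}
          = {(p, q, l). \<bar>real p - v1 * real N\<bar> > \<epsilon> * real N}"
        using theta_bounds(2) by auto
      finally show ?case .
    qed
    have "(\<lambda>N. D * C1 * (real N ^ 4 * r1 ^ N)) \<longlonglongrightarrow> D * C1 * 0"
      using 1 by (intro tendsto_mult_left poly_times_power_tendsto_0) auto
    then show "(\<lambda>N. D * C1 * (real N ^ 4 * r1 ^ N)) \<longlonglongrightarrow> 0" by simp
  qed (use D 1 in auto)
  show ?Q
  proof (rule measure_tendsto_0[where b = "\<lambda>N. D * C2 / (1 - q1) * (real N ^ 5 * r2 ^ N)"])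
    show "\<forall>\<^sub>F N in sequentially. emeasure (P_Geo a c1 c2 N) (event N {(p, q, l). \<bar>real q - v2 * real N\<bar> > \<epsilon> * real N})
        \<le> ennreal (D * C2 / (1 - q1) * (real N ^ 5 * r2 ^ N))"
      using ev eventually_ge_at_top[of 1]
    proof eventually_elim
      case (elim N)
      have "1 * neg_binom q2 N k \<le> (real k + 1) * neg_binom q2 N k" for k
        using q2 by (intro mult_right_mono neg_binom_nonneg) auto
      then have "(\<integral>\<^sup>+k. ennreal (neg_binom q2 N k) * indicator (?B N) k \<partial>count_space UNIV)
          \<le> (\<integral>\<^sup>+k. ennreal ((real k + 1) * neg_binom q2 N k) * indicator (?B N) k \<partial>count_space UNIV)"
        by (intro nn_integral_mono mult_right_mono ennreal_leI) auto
      also note I2[OF elim(2)]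
      finally have J: "(\<integral>\<^sup>+k. ennreal (neg_binom q2 N k) * indicator (?B N) k \<partial>count_space UNIV)
          \<le> ennreal (C2 * real N * r2 ^ N)" .
      have "emeasure (P_Geo a c1 c2 N) (event N {(p, q, l). p \<in> UNIV \<and> q \<in> ?B N \<and> \<theta> p q l \<le> 1})
        \<le> ennreal (D * real N ^ 3 * 1)
          * (\<integral>\<^sup>+p. ennreal ((real p + 1) * neg_binom q1 N p) * indicator UNIV p \<partial>count_space UNIV)
          * (\<integral>\<^sup>+q. ennreal (neg_binom q2 N q) * indicator (?B N) q \<partial>count_space UNIV)"
        by (intro elim(1)[rule_format]) auto
      also have "\<dots> \<le> ennreal (D * real N ^ 3) * ennreal (real N / (1 - q1)) * ennreal (C2 * real N * r2 ^ N)"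
        using nn_integral_Suc_times_neg_binom_le[OF q1 elim(2)] J
        by (intro mult_mono) auto
      also have "\<dots> = ennreal (D * real N ^ 3 * (real N / (1 - q1)) * (C2 * real N * r2 ^ N))"
        using D 2 q1 by (intro ennreal_mult_triple) auto
      also have "D * real N ^ 3 * (real N / (1 - q1)) * (C2 * real N * r2 ^ N) = D * C2 / (1 - q1) * (real N ^ 5 * r2 ^ N)"
        by (simp add: eval_nat_numeral)
      also have "{(p, q, l). p \<in> UNIV \<and> q \<in> ?B N \<and> \<theta> p q l \<le> 1}
          = {(p, q, l). \<bar>real q - v2 * real N\<bar> > \<epsilon> * real N}"
        using theta_bounds(2) by auto
      finally show ?case .
    qed
    have "(\<lambda>N. D * C2 / (1 - q1) * (real N ^ 5 * r2 ^ N)) \<longlonglongrightarrow> D * C2 / (1 - q1) * 0"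
      using 2 by (intro tendsto_mult_left poly_times_power_tendsto_0) auto
    then show "(\<lambda>N. D * C2 / (1 - q1) * (real N ^ 5 * r2 ^ N)) \<longlonglongrightarrow> 0" by simp
  qed (use D 2 q1 in auto)
qed

end

section \<open>The limit theorems\<close>

lemma shape_L1: "shape N L = (p, q, l) \<Longrightarrow> fst L N = l"
  by (auto simp: shape_def split: prod.splits)

context geo
begin

section \<open>The three regimes with a deterministic limit\<close>

lemma event_memI:
  assumes "N \<ge> 1" "L \<in> paths N \<times> paths N"
    and "\<And>p q l. q \<le> l \<Longrightarrow> l \<le> p \<Longrightarrow> fst L N = l \<Longrightarrow> (p, q, l) \<in> A \<or> (p, q, l) \<in> B"
  shows "L \<in> event N A \<union> event N B"
proof -
  obtain p q l where "shape N L = (p, q, l)" by (cases "shape N L")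
  then show ?thesis
    using shape_bounds[OF assms(1,2)] shape_L1[of N L] assms(2,3) by (auto simp: event_def)
qed

text \<open>Leaves to each regime a deterministic implication between shapes and two families of
  events whose probabilities vanish.\<close>

lemma conv_in_probI:
  assumes "\<And>\<epsilon> N p q l. \<epsilon> > 0 \<Longrightarrow> N \<ge> 1 \<Longrightarrow> q \<le> l \<Longrightarrow> l \<le> p \<Longrightarrow> \<bar>real l - v * real N\<bar> > \<epsilon> * real N
      \<Longrightarrow> (p, q, l) \<in> A \<epsilon> N \<or> (p, q, l) \<in> B \<epsilon> N"
    and "\<And>\<epsilon>. \<epsilon> > 0 \<Longrightarrow> (\<lambda>N. measure (P_Geo a c1 c2 N) (event N (A \<epsilon> N))) \<longlonglongrightarrow> 0"
    and "\<And>\<epsilon>. \<epsilon> > 0 \<Longrightarrow> (\<lambda>N. measure (P_Geo a c1 c2 N) (event N (B \<epsilon> N))) \<longlonglongrightarrow> 0"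
  shows "conv_in_prob_const (P_Geo a c1 c2) (\<lambda>N (L1, L2). real (L1 N) / real N) v"
  unfolding conv_in_prob_const_def
proof (intro allI impI)
  fix \<epsilon> :: real assume e: "\<epsilon> > 0"
  show "(\<lambda>N. measure (P_Geo a c1 c2 N) {L \<in> space (P_Geo a c1 c2 N).
      \<bar>(case L of (L1, L2) \<Rightarrow> real (L1 N) / real N) - v\<bar> > \<epsilon>}) \<longlonglongrightarrow> 0"
  proof (rule measure_cover_tendsto_0[OF _ assms(2,3)[OF e]])
    fix N :: nat assume N: "N \<ge> 1"
    show "{L \<in> space (P_Geo a c1 c2 N). \<bar>(case L of (L1, L2) \<Rightarrow> real (L1 N) / real N) - v\<bar> > \<epsilon>}
      \<subseteq> event N (A \<epsilon> N) \<union> event N (B \<epsilon> N)"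
    proof
      fix L assume "L \<in> {L \<in> space (P_Geo a c1 c2 N). \<bar>(case L of (L1, L2) \<Rightarrow> real (L1 N) / real N) - v\<bar> > \<epsilon>}"
      then have L: "L \<in> paths N \<times> paths N" and dev: "\<bar>real (fst L N) / real N - v\<bar> > \<epsilon>"
        by (auto simp: space_P_Geo)
      have "\<epsilon> * real N < \<bar>real (fst L N) / real N - v\<bar> * real N"
        using N dev by (intro mult_strict_right_mono) auto
      also have "\<dots> = \<bar>(real (fst L N) / real N - v) * real N\<bar>"
        by (simp add: abs_mult)
      also have "(real (fst L N) / real N - v) * real N = real (fst L N) - v * real N"
        using N by (simp add: left_diff_distrib)
      finally show "L \<in> event N (A \<epsilon> N) \<union> event N (B \<epsilon> N)"
        using N L e assms(1) by (intro event_memI) auto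
    qed
  qed
qed

text \<open>Here \<open>v1 = v2\<close>, so by \<open>q \<le> l \<le> p\<close> an \<open>l\<close>
  that is too large drags \<open>p\<close> along, and one that is too small drags
  \<open>q\<close>.\<close>

lemma conv_in_prob_subcritical:
  assumes "c1 \<le> 1" "c2 \<le> 1"
  shows "conv_in_prob_const (P_Geo a c1 c2) (\<lambda>N (L1, L2). real (L1 N) / real N) (a / (1 - a))"
proof -
  have "c = 1" using assms by (simp add: c_def)
  then have v: "v1 = a / (1 - a)" "v2 = a / (1 - a)"
    by (simp_all add: v1_def v2_def q1_def q2_def)
  show ?thesis
  proof (rule conv_in_probI[OF _ shape_concentration])
    fix \<epsilon> :: real and N p q l :: nat
    assume "q \<le> l" "l \<le> p" "\<epsilon> * real N < \<bar>real l - a / (1 - a) * real N\<bar>"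
    then show "(p, q, l) \<in> {(p, q, l). \<epsilon> * real N < \<bar>real p - v1 * real N\<bar>} \<or>
        (p, q, l) \<in> {(p, q, l). \<epsilon> * real N < \<bar>real q - v2 * real N\<bar>}"
      unfolding v by (auto simp: abs_if split: if_splits)
  qed auto
qed

lemma power_le_geometric:
  fixes r e :: real
  assumes "0 < r" "r < 1" "e * real N \<le> real k"
  shows "r ^ k \<le> (r powr e) ^ N"
proof -
  have "r ^ k = r powr real k" using assms by (simp add: powr_realpow)
  also have "\<dots> \<le> r powr (e * real N)" using assms by (intro powr_mono') auto
  also have "\<dots> = (r powr e) ^ N" using assms by (simp add: powr_powr flip: powr_realpow)
  finally show ?thesis .
qed

text \<open>Now \<open>\<theta>\<close> is \<open>(c2 / c1) ^ (l - q)\<close>. If \<open>l\<close>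
  deviates from \<open>v2 * N\<close> by \<open>\<epsilon> * N\<close>, then either \<open>q\<close>
  deviates by half as much or \<open>l - q\<close> is so large that \<open>\<theta>\<close> is
  exponentially small.\<close>

lemma conv_in_prob_left:
  assumes "1 < c1" "c2 < c1"
  shows "conv_in_prob_const (P_Geo a c1 c2) (\<lambda>N (L1, L2). real (L1 N) / real N) (a / (c1 - a))"
proof -
  have cc: "c = c1" using assms by (simp add: c_def)
  have v: "a / (c1 - a) = v2"
    using assms a by (simp add: v2_def q2_def cc field_simps)
  define r where "r = c2 / c1"
  have r: "0 < r" "r < 1" using assms c2 c1 by (auto simp: r_def)
  have theta: "\<theta> p q l = r ^ (l - q)" for p q l
    using c1 by (simp add: \<theta>_def cc r_def)
  show ?thesis
    unfolding v
  proof (rule conv_in_probI)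
    fix \<epsilon> :: real assume e: "\<epsilon> > 0"
    show "(\<lambda>N. measure (P_Geo a c1 c2 N) (event N {(p, q, l). \<theta> p q l \<le> (r powr (\<epsilon> / 2)) ^ N})) \<longlonglongrightarrow> 0"
      using r e powr_less_mono2[of "\<epsilon> / 2" r 1] by (intro theta_not_small) auto
    show "(\<lambda>N. measure (P_Geo a c1 c2 N) (event N {(p, q, l). \<bar>real q - v2 * real N\<bar> > \<epsilon> / 2 * real N})) \<longlonglongrightarrow> 0"
      using e by (intro shape_concentration) auto
  next
    fix \<epsilon> :: real and N p q l :: nat
    assume *: "\<epsilon> > 0" "q \<le> l" "l \<le> p" "\<epsilon> * real N < \<bar>real l - v2 * real N\<bar>"
    then have "\<epsilon> / 2 * real N \<le> real (l - q) \<or> \<epsilon> / 2 * real N < \<bar>real q - v2 * real N\<bar>"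
      unfolding of_nat_diff[OF *(2)] of_nat_diff[OF *(3)] by linarith
    then show "(p, q, l) \<in> {(p, q, l). \<theta> p q l \<le> (r powr (\<epsilon> / 2)) ^ N} \<or>
        (p, q, l) \<in> {(p, q, l). \<epsilon> / 2 * real N < \<bar>real q - v2 * real N\<bar>}"
      using power_le_geometric[OF r] by (auto simp: theta)
  qed
qed

text \<open>The mirror image: \<open>\<theta>\<close> is \<open>(c1 / c2) ^ (p - l)\<close>, which
  ties \<open>l\<close> to \<open>p\<close> instead of \<open>q\<close>.\<close>

lemma conv_in_prob_right:
  assumes "1 < c2" "c1 < c2"
  shows "conv_in_prob_const (P_Geo a c1 c2) (\<lambda>N (L1, L2). real (L1 N) / real N) (a * c2 / (1 - a * c2))"
proof -
  have cc: "c = c2" using assms by (simp add: c_def)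
  have v: "a * c2 / (1 - a * c2) = v1" by (simp add: v1_def q1_def cc)
  define r where "r = c1 / c2"
  have r: "0 < r" "r < 1" using assms c2 c1 by (auto simp: r_def)
  have theta: "\<theta> p q l = r ^ (p - l)" for p q l
    using c2 by (simp add: \<theta>_def cc r_def)
  show ?thesis
    unfolding v
  proof (rule conv_in_probI)
    fix \<epsilon> :: real assume e: "\<epsilon> > 0"
    show "(\<lambda>N. measure (P_Geo a c1 c2 N) (event N {(p, q, l). \<theta> p q l \<le> (r powr (\<epsilon> / 2)) ^ N})) \<longlonglongrightarrow> 0"
      using r e powr_less_mono2[of "\<epsilon> / 2" r 1] by (intro theta_not_small) auto
    show "(\<lambda>N. measure (P_Geo a c1 c2 N) (event N {(p, q, l). \<bar>real p - v1 * real N\<bar> > \<epsilon> / 2 * real N})) \<longlonglongrightarrow> 0"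
      using e by (intro shape_concentration) auto
  next
    fix \<epsilon> :: real and N p q l :: nat
    assume *: "\<epsilon> > 0" "q \<le> l" "l \<le> p" "\<epsilon> * real N < \<bar>real l - v1 * real N\<bar>"
    then have "\<epsilon> / 2 * real N \<le> real (p - l) \<or> \<epsilon> / 2 * real N < \<bar>real p - v1 * real N\<bar>"
      unfolding of_nat_diff[OF *(2)] of_nat_diff[OF *(3)] by linarith
    then show "(p, q, l) \<in> {(p, q, l). \<theta> p q l \<le> (r powr (\<epsilon> / 2)) ^ N} \<or>
        (p, q, l) \<in> {(p, q, l). \<epsilon> / 2 * real N < \<bar>real p - v1 * real N\<bar>}"
      using power_le_geometric[OF r] by (auto simp: theta)
  qed
qed

section \<open>The diagonal regime with a random limit\<close>

text \<open>
  For \<open>c1 = c2\<close> the mass of a shape does not depend on its last component, which is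
  therefore conditionally uniform given the other two.
\<close>

lemma conditionally_uniform:
  assumes "N \<ge> 1" "c1 = c2" "\<kappa> \<ge> 0"
    and "\<And>p q. (p, q) \<in> G \<Longrightarrow> q \<le> p \<Longrightarrow> real (card ({q..p} \<inter> E)) \<le> \<kappa> * (real p - real q + 1)"
  shows "measure (P_Geo a c1 c2 N) (event N {(p, q, l). (p, q) \<in> G \<and> l \<in> E}) \<le> \<kappa>"
proof -
  interpret prob_space "P_Geo a c1 c2 N" by (rule prob_space_P[OF assms(1)])
  let ?B = "{(p, q, l). (p, q) \<in> G \<and> l \<in> E}"
  let ?m = "\<lambda>t. ennreal (shape_mass a c1 c2 N t / Z_Geo a c1 c2 N)"
  have row: "(\<integral>\<^sup>+l. ?m (p, q, l) * indicator ?B (p, q, l) \<partial>count_space UNIV)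
      \<le> ennreal \<kappa> * (\<integral>\<^sup>+l. ?m (p, q, l) \<partial>count_space UNIV)" for p q
  proof (cases "(p, q) \<in> G \<and> q \<le> p")
    case True
    \<comment> \<open>The mass at \<open>l = q\<close> represents the whole row: for equal boundary
      parameters the exponents \<open>p - l\<close> and \<open>l - q\<close> add up to
      \<open>p - q\<close>.\<close>
    define w where "w = ?m (p, q, q)"
    have m: "?m (p, q, l) = w * indicator {q..p} l" for l
    proof (cases "l \<in> {q..p}")
      case True
      then have "c2 ^ (p - q) = c2 ^ (p - l) * c2 ^ (l - q)" by (simp flip: power_add)
      then have "shape_mass a c1 c2 N (p, q, l) = shape_mass a c1 c2 N (p, q, q)"
        using True assms(2) by (simp add: shape_mass_def)
      then show ?thesis using True by (simp add: w_def)
    qed (auto simp: shape_mass_def)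
    have "(\<integral>\<^sup>+l. ?m (p, q, l) * indicator ?B (p, q, l) \<partial>count_space UNIV)
        = (\<integral>\<^sup>+l. w * indicator ({q..p} \<inter> E) l \<partial>count_space UNIV)"
      using True unfolding m by (intro nn_integral_cong) (auto simp: indicator_def)
    also have "\<dots> = w * ennreal (real (card ({q..p} \<inter> E)))"
      by (simp add: nn_integral_cmult_indicator flip: ennreal_of_nat_eq_real_of_nat)
    also have "\<dots> \<le> w * ennreal (\<kappa> * real (card {q..p}))"
      using assms(4)[of p q] True by (intro mult_left_mono ennreal_leI) (auto simp: of_nat_diff add_ac add_diff_eq)
    also have "\<dots> = ennreal \<kappa> * (w * ennreal (real (card {q..p})))"
      using assms(3) by (simp only: ennreal_mult of_nat_0_le_iff mult_ac)
    also have "w * ennreal (real (card {q..p})) = (\<integral>\<^sup>+l. ?m (p, q, l) \<partial>count_space UNIV)"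
      unfolding m by (simp add: nn_integral_cmult_indicator flip: ennreal_of_nat_eq_real_of_nat)
    finally show ?thesis .
  next
    case False
    then have "?m (p, q, l) * indicator ?B (p, q, l) = 0" for l
      by (auto simp: shape_mass_def indicator_def)
    then show ?thesis by (simp only: nn_integral_const mult_zero_left zero_le)
  qed
  have "emeasure (P_Geo a c1 c2 N) (event N ?B) = (\<integral>\<^sup>+t. ?m t * indicator ?B t \<partial>count_space UNIV)"
    unfolding event_def by (rule emeasure_shape[OF assms(1)])
  also have "\<dots> \<le> (\<integral>\<^sup>+p. \<integral>\<^sup>+q. ennreal \<kappa> * (\<integral>\<^sup>+l. ?m (p, q, l) \<partial>count_space UNIV) \<partial>count_space UNIV \<partial>count_space UNIV)"
    unfolding nn_integral_triple by (intro nn_integral_mono row)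
  also have "\<dots> = ennreal \<kappa> * (\<integral>\<^sup>+p. \<integral>\<^sup>+q. \<integral>\<^sup>+l. ?m (p, q, l) \<partial>count_space UNIV \<partial>count_space UNIV \<partial>count_space UNIV)"
    by (simp only: nn_integral_cmult borel_measurable_count_space)
  also have "\<dots> = ennreal \<kappa> * emeasure (P_Geo a c1 c2 N) (event N UNIV)"
    unfolding nn_integral_triple[symmetric, of ?m] event_def emeasure_shape[OF assms(1)] by simp
  also have "\<dots> \<le> ennreal \<kappa> * 1"
    by (intro mult_left_mono emeasure_le_1) auto
  finally show ?thesis
    using assms(3) by (simp add: emeasure_eq_measure)
qed

text \<open>Outside an event of small probability, \<open>l\<close> is uniform on a range of about
  \<open>(v1 - v2) * N\<close> integers, of which \<open>E N\<close> allows about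
  \<open>(t - s) * N\<close>. An upper bound is enough, since \<open>cdf_tendsto\<close> applies it
  to an event and to its complement.\<close>

lemma interval_prob_le:
  fixes s t \<delta> :: real
  assumes "c1 = c2" "1 < c" "\<delta> > 0" "s \<le> t"
    and E: "\<And>\<epsilon> N p q l. \<epsilon> > 0 \<Longrightarrow> N \<ge> 1 \<Longrightarrow> \<bar>real p - v1 * real N\<bar> \<le> \<epsilon> * real N
      \<Longrightarrow> \<bar>real q - v2 * real N\<bar> \<le> \<epsilon> * real N \<Longrightarrow> q \<le> l \<Longrightarrow> l \<le> p \<Longrightarrow> l \<in> E N
      \<Longrightarrow> (s - \<epsilon>) * real N \<le> real l \<and> real l \<le> (t + \<epsilon>) * real N"
  shows "\<forall>\<^sub>F N in sequentially. measure (P_Geo a c1 c2 N) {L \<in> paths N \<times> paths N. fst L N \<in> E N}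
    \<le> (t - s) / (v1 - v2) + \<delta>"
proof -
  define d where "d = v1 - v2"
  have d: "d > 0" using v2_less_v1[OF assms(2)] by (simp add: d_def)
  \<comment> \<open>The numerator gains \<open>2 * \<epsilon>\<close> from widening the interval at
    both ends and \<open>\<epsilon>\<close> from the \<open>+ 1\<close> in counting integers, once
    \<open>1 \<le> \<epsilon> * N\<close>. The denominator loses \<open>2 * \<epsilon>\<close>
    through the errors in \<open>p\<close> and \<open>q\<close>.\<close>
  have "((\<lambda>\<epsilon>. ((t - s) + 3 * \<epsilon>) / (d - 2 * \<epsilon>)) \<longlongrightarrow> ((t - s) + 3 * 0) / (d - 2 * 0)) (at_right 0)"
    using d by (intro tendsto_intros) auto
  then have "\<forall>\<^sub>F \<epsilon> in at_right 0. ((t - s) + 3 * \<epsilon>) / (d - 2 * \<epsilon>) < (t - s) / d + \<delta> / 2"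
    by (rule order_tendstoD) (use assms in auto)
  moreover have "\<forall>\<^sub>F \<epsilon> in at_right (0::real). 0 < \<epsilon> \<and> \<epsilon> < d / 2"
    using d by (auto simp: eventually_at_right intro!: exI[of _ "d / 2"])
  ultimately have "\<forall>\<^sub>F \<epsilon> in at_right 0. ((t - s) + 3 * \<epsilon>) / (d - 2 * \<epsilon>) < (t - s) / d + \<delta> / 2
      \<and> 0 < \<epsilon> \<and> \<epsilon> < d / 2"
    by eventually_elim auto
  then obtain \<epsilon> where e: "((t - s) + 3 * \<epsilon>) / (d - 2 * \<epsilon>) < (t - s) / d + \<delta> / 2" "0 < \<epsilon>" "\<epsilon> < d / 2"
    using eventually_happens'[OF trivial_limit_at_right_real] by blast
  define \<kappa> where "\<kappa> = ((t - s) + 3 * \<epsilon>) / (d - 2 * \<epsilon>)"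
  have k: "\<kappa> \<ge> 0" using e assms(4) by (simp add: \<kappa>_def)
  define Bp where "Bp = (\<lambda>N. {(p, q, l). \<bar>real p - v1 * real N\<bar> > \<epsilon> * real N} :: (nat \<times> nat \<times> nat) set)"
  define Bq where "Bq = (\<lambda>N. {(p, q, l). \<bar>real q - v2 * real N\<bar> > \<epsilon> * real N} :: (nat \<times> nat \<times> nat) set)"
  let ?P = "\<lambda>N. measure (P_Geo a c1 c2 N)"
  have "(\<lambda>N. ?P N (event N (Bp N)) + ?P N (event N (Bq N))) \<longlonglongrightarrow> 0 + 0"
    unfolding Bp_def Bq_def by (intro tendsto_add shape_concentration e)
  then have "\<forall>\<^sub>F N in sequentially. ?P N (event N (Bp N)) + ?P N (event N (Bq N)) < \<delta> / 2"
    by (rule order_tendstoD) (use assms in auto)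
  moreover have "\<forall>\<^sub>F N in sequentially. 1 / \<epsilon> \<le> real N"
    by (meson eventually_sequentiallyI nat_ceiling_le_eq)
  ultimately show ?thesis
    using eventually_ge_at_top[of 1]
  proof eventually_elim
    case (elim N)
    define G where "G = {(p, q). \<bar>real p - v1 * real N\<bar> \<le> \<epsilon> * real N \<and> \<bar>real q - v2 * real N\<bar> \<le> \<epsilon> * real N}"
    let ?U = "{(p, q, l). (p, q) \<in> G \<and> l \<in> E N}"
    have eN: "1 \<le> \<epsilon> * real N" using elim e by (simp add: field_simps)
    have "?P N (event N ?U) \<le> \<kappa>"
    proof (rule conditionally_uniform[OF elim(3) assms(1) k])
      fix p q assume pq: "(p, q) \<in> G" "q \<le> p"
      have "real (card ({q..p} \<inter> E N)) \<le> (t + \<epsilon>) * real N - (s - \<epsilon>) * real N + 1"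
      proof (rule card_nat_interval_le)
        show "(s - \<epsilon>) * real N \<le> (t + \<epsilon>) * real N"
          using assms(4) e by (intro mult_right_mono) auto
        show "(s - \<epsilon>) * real N \<le> real l \<and> real l \<le> (t + \<epsilon>) * real N" if "l \<in> {q..p} \<inter> E N" for l
          using that pq e elim by (intro E[of \<epsilon> N p q l]) (auto simp: G_def)
      qed auto
      also have "\<dots> \<le> ((t - s) + 3 * \<epsilon>) * real N" using eN by (simp add: algebra_simps)
      also have "\<dots> = \<kappa> * ((d - 2 * \<epsilon>) * real N)" using e by (simp add: \<kappa>_def)
      also have "\<dots> \<le> \<kappa> * (real p - real q + 1)"
        using pq k by (intro mult_left_mono) (auto simp: G_def d_def algebra_simps abs_le_iff)
      finally show "real (card ({q..p} \<inter> E N)) \<le> \<kappa> * (real p - real q + 1)" .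
    qed
    moreover have "{L \<in> paths N \<times> paths N. fst L N \<in> E N} \<subseteq> event N ?U \<union> event N (Bp N \<union> Bq N)"
      using elim(3) by (intro subsetI event_memI) (auto simp: G_def Bp_def Bq_def)
    then have "?P N {L \<in> paths N \<times> paths N. fst L N \<in> E N} \<le> ?P N (event N ?U) + ?P N (event N (Bp N \<union> Bq N))"
      by (rule measure_event_cover[OF elim(3)])
    moreover have "?P N (event N (Bp N \<union> Bq N)) \<le> ?P N (event N (Bp N)) + ?P N (event N (Bq N))"
      by (rule measure_event_cover[OF elim(3)]) (auto simp: event_def)
    ultimately show ?case using elim(1) e(1) unfolding \<kappa>_def d_def by linarith
  qed
qed

text \<open>The upper bounds for \<open>l / N \<le> x\<close> and for its complement add up to
  \<open>1 + \<delta>\<close>, so the second one is a lower bound for the first event. Clamping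
  \<open>x\<close> to the interval from \<open>v2\<close> to \<open>v1\<close> reflects that
  \<open>l / N\<close> asymptotically stays there.\<close>

lemma cdf_tendsto:
  assumes "c1 = c2" "1 < c"
  shows "(\<lambda>N. measure (P_Geo a c1 c2 N) {L \<in> paths N \<times> paths N. real (fst L N) / real N \<le> x})
    \<longlonglongrightarrow> (max v2 (min x v1) - v2) / (v1 - v2)"
proof -
  define y where "y = max v2 (min x v1)"
  have d: "v1 - v2 > 0" using v2_less_v1[OF assms(2)] by simp
  have y: "v2 \<le> y" "y \<le> v1" using d by (auto simp: y_def)
  let ?P = "\<lambda>N. measure (P_Geo a c1 c2 N)"
  let ?X = "\<lambda>N. {L \<in> paths N \<times> paths N. real (fst L N) / real N \<le> x}"
  have "\<forall>\<^sub>F N in sequentially. dist (?P N (?X N)) ((y - v2) / (v1 - v2)) < \<delta>" if \<delta>: "\<delta> > 0" for \<delta>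
  proof -
    have "\<forall>\<^sub>F N in sequentially. ?P N {L \<in> paths N \<times> paths N. fst L N \<in> {l. real l / real N \<le> x}}
        \<le> (y - v2) / (v1 - v2) + \<delta> / 2"
    proof (rule interval_prob_le[OF assms])
      fix \<epsilon> :: real and N p q l :: nat
      assume *: "\<epsilon> > 0" "N \<ge> 1" "\<bar>real p - v1 * real N\<bar> \<le> \<epsilon> * real N" "\<bar>real q - v2 * real N\<bar> \<le> \<epsilon> * real N"
        "q \<le> l" "l \<le> p" "l \<in> {l. real l / real N \<le> x}"
      have lx: "real l \<le> x * real N" using * by (simp add: field_simps)
      have "real l \<le> (v1 + \<epsilon>) * real N" using * by (auto simp: algebra_simps abs_le_iff)
      moreover have "x * real N \<le> (y + \<epsilon>) * real N" if "x \<le> v1"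
        using that * by (intro mult_right_mono) (auto simp: y_def)
      moreover have "y = v1" if "x > v1" using that d by (simp add: y_def)
      ultimately have "real l \<le> (y + \<epsilon>) * real N" using lx by (cases "x \<le> v1") auto
      moreover have "(v2 - \<epsilon>) * real N \<le> real l" using * by (auto simp: algebra_simps abs_le_iff)
      ultimately show "(v2 - \<epsilon>) * real N \<le> real l \<and> real l \<le> (y + \<epsilon>) * real N" by simp
    qed (use \<delta> y in auto)
    moreover have "\<forall>\<^sub>F N in sequentially. ?P N {L \<in> paths N \<times> paths N. fst L N \<in> {l. real l / real N > x}}
        \<le> (v1 - y) / (v1 - v2) + \<delta> / 2"
    proof (rule interval_prob_le[OF assms])
      fix \<epsilon> :: real and N p q l :: nat
      assume *: "\<epsilon> > 0" "N \<ge> 1" "\<bar>real p - v1 * real N\<bar> \<le> \<epsilon> * real N" "\<bar>real q - v2 * real N\<bar> \<le> \<epsilon> * real N"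
        "q \<le> l" "l \<le> p" "l \<in> {l. real l / real N > x}"
      have lx: "x * real N \<le> real l" using * by (simp add: field_simps)
      have "(v2 - \<epsilon>) * real N \<le> real l" using * by (auto simp: algebra_simps abs_le_iff)
      moreover have "(y - \<epsilon>) * real N \<le> x * real N" if "v2 \<le> x"
        using that * d by (intro mult_right_mono) (auto simp: y_def)
      moreover have "y = v2" if "x < v2" using that d by (simp add: y_def)
      ultimately have "(y - \<epsilon>) * real N \<le> real l" using lx by (cases "v2 \<le> x") auto
      moreover have "real l \<le> (v1 + \<epsilon>) * real N" using * by (auto simp: algebra_simps abs_le_iff)
      ultimately show "(y - \<epsilon>) * real N \<le> real l \<and> real l \<le> (v1 + \<epsilon>) * real N" by simp
    qed (use \<delta> y in auto)
    ultimately show ?thesis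
      using eventually_ge_at_top[of 1]
    proof eventually_elim
      case (elim N)
      interpret prob_space "P_Geo a c1 c2 N" by (rule prob_space_P[OF elim(3)])
      have "prob (space (P_Geo a c1 c2 N) - ?X N) = 1 - prob (?X N)"
        by (intro prob_compl) (auto simp: sets_P_Geo)
      moreover have "space (P_Geo a c1 c2 N) - ?X N = {L \<in> paths N \<times> paths N. fst L N \<in> {l. real l / real N > x}}"
        by (auto simp: space_P_Geo)
      moreover have "(v1 - y) / (v1 - v2) = 1 - (y - v2) / (v1 - v2)"
        using d by (simp add: field_simps)
      ultimately show ?case using elim(1,2) \<delta> by (simp add: dist_real_def abs_less_iff)
    qed
  qed
  then show ?thesis unfolding y_def[symmetric] by (intro tendstoI) auto
qed

lemma cdf_limit:
  assumes "v2 < v1"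
  shows "cdf (distr (uniform_measure lborel {0..1}) borel (\<lambda>U. v2 * U + v1 * (1 - U))) x
    = (max v2 (min x v1) - v2) / (v1 - v2)"
proof -
  define w where "w = (v1 - x) / (v1 - v2)"
  have "cdf (distr (uniform_measure lborel {0..1}) borel (\<lambda>U. v2 * U + v1 * (1 - U))) x
      = measure (uniform_measure lborel {0..1}) ((\<lambda>U. v2 * U + v1 * (1 - U)) -` {..x})"
    unfolding cdf_def by (subst measure_distr) auto
  \<comment> \<open>The map decreases in \<open>U\<close> because \<open>v2 < v1\<close>, so a lower
    half-line pulls back to an upper one.\<close>
  also have "(\<lambda>U. v2 * U + v1 * (1 - U)) -` {..x} = {w..}"
    using assms by (auto simp: w_def field_simps)
  also have "measure (uniform_measure lborel {0..1}) {w..} = measure lborel ({0..1} \<inter> {w..}) / measure lborel {0..1::real}"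
    by (rule measure_uniform_measure) auto
  also have "{0..1} \<inter> {w..} = {max 0 w..1}" by auto
  also have "measure lborel {max 0 w..1} / measure lborel {0..1::real} = (if w \<le> 1 then 1 - max 0 w else 0)"
    by simp
  also have "\<dots> = (max v2 (min x v1) - v2) / (v1 - v2)"
    using assms by (auto simp: w_def max_def min_def field_simps)
  finally show ?thesis .
qed

text \<open>The distribution functions converge at every \<open>x\<close>, hence at the continuity
  points of the limit; the coefficients are \<open>v2\<close> and \<open>v1\<close> for
  \<open>c = c1\<close>.\<close>

lemma weak_conv_diagonal:
  assumes "c1 = c2" "1 < c1"
  shows "weak_conv_m
    (\<lambda>N. distr (P_Geo a c1 c2 N) borel (\<lambda>(L1, L2). real (L1 N) / real N))
    (distr (uniform_measure lborel {0..1}) borel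
      (\<lambda>U. a / (c1 - a) * U + a * c1 / (1 - a * c1) * (1 - U)))"
proof -
  have cc: "c = c1" unfolding c_def using assms by simp
  have v: "a / (c1 - a) = v2" "a * c1 / (1 - a * c1) = v1"
    unfolding v1_def q1_def v2_def q2_def cc using assms a by (simp_all add: field_simps)
  have "cdf (distr (P_Geo a c1 c2 N) borel (\<lambda>(L1, L2). real (L1 N) / real N)) x
      = measure (P_Geo a c1 c2 N) {L \<in> paths N \<times> paths N. real (fst L N) / real N \<le> x}" for N x
    unfolding cdf_def
    by (subst measure_distr)
      (auto simp: measurable_def sets_P_Geo space_P_Geo intro!: arg_cong2[where f = measure])
  moreover have "1 < c" unfolding cc by (rule assms(2))
  ultimately show ?thesis
    unfolding weak_conv_m_def weak_conv_def v
    using cdf_tendsto[OF assms(1)] cdf_limit[OF v2_less_v1] by simp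
qed

end

theorem theorem1p3:
  fixes a c1 c2 :: real
  assumes "a \<in> {0<..<1}" and "c1 \<in> {0<..<1 / a}" and "c2 \<in> {0<..<1 / a}"
  shows
    "(c1 \<le> 1 \<and> c2 \<le> 1 \<longrightarrow>
        conv_in_prob_const (P_Geo a c1 c2) (\<lambda>N (L1, L2). real (L1 N) / real N) (a / (1 - a)))
   \<and> (1 < c1 \<and> c2 < c1 \<and> c1 < 1 / a \<longrightarrow>
        conv_in_prob_const (P_Geo a c1 c2) (\<lambda>N (L1, L2). real (L1 N) / real N) (a / (c1 - a)))
   \<and> (1 < c2 \<and> c1 < c2 \<and> c2 < 1 / a \<longrightarrow>
        conv_in_prob_const (P_Geo a c1 c2) (\<lambda>N (L1, L2). real (L1 N) / real N)
          (a * c2 / (1 - a * c2)))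
   \<and> (\<forall>c\<in>{1<..<1 / a}. c1 = c \<and> c2 = c \<longrightarrow>
        weak_conv_m
          (\<lambda>N. distr (P_Geo a c1 c2 N) borel (\<lambda>(L1, L2). real (L1 N) / real N))
          (distr (uniform_measure lborel {0..1}) borel
            (\<lambda>U. a / (c - a) * U + a * c / (1 - a * c) * (1 - U))))"
proof -
  interpret geo a c1 c2
    using assms by unfold_locales (auto simp: field_simps)
  show ?thesis
    using conv_in_prob_subcritical conv_in_prob_left conv_in_prob_right weak_conv_diagonal by auto
qed

end
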